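(* Assume the following. (1) The weighted digraph $\mathcal G$ is strongly connected (it need not be weight-balanced). (2) For each $i\in\mathcal V$ the nonlinearity $f_i$ satisfies, for all $x_i,x_i^{(1)},\dots,x_i^{(n-1)},\check x_i,\check x_i^{(1)},\dots,\check x_i^{(n-1)}\in\mathbb R^m$, $$\|f_i(x_i,x_i^{(1)},\dots,x_i^{(n-1)},w_i)-f_i(\check x_i,\check x_i^{(1)},\dots,\check x_i^{(n-1)},w_i)\|\le l_x\|x_i-\check x_i\|+\sum_{l=1}^{n-1}l_{x^{(l)}}\|x_i^{(l)}-\check x_i^{(l)}\|,$$ with constants $l_x,l_{x^{(l)}}\ge 0$. (3) For each $i\in\mathcal V$, $J_i(x_i,x_{-i})$ is continuously differentiable in $x$ and convex in $x_i$ for every fixed $x_{-i}$. (4) The pseudo-gradient $\mathcal F$ is $\omega$-strongly monotone and $\theta$-Lipschitz continuous for some $\omega,\theta>0$. Let $k_1,\dots,k_{n-1}$ be real numbers such that all roots of $s^{n-1}+k_{n-1}s^{n-2}+\dots+k_2s+k_1$ lie in the open left half plane. Then there exist positive constants $\alpha_1,\alpha_2,\alpha_3,\varepsilon$ such that the players with $n$th-order nonlinear dynamics under the state-based algorithm (both given in the context) exponentially converge to the Nash equilibrium $x^*$ of the game: there is $\lambda>0$ such that for every solution of the closed-loop system there is $C>0$ with $\|x(t)-x^*\|\le Ce^{-\lambda t}$ for all $t\ge 0$, where $x(t)=(x_1(t),\dots,x_N(t))$.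
   Context: Graph. $\mathcal G$ is a weighted digraph on $\mathcal V=\{1,\dots,N\}$ with adjacency matrix $[a_{ij}]$, where $a_{ij}>0$ if $i$ receives information from $j$, $a_{ij}=0$ otherwise, and $a_{ii}=0$. Game. Player $i\in\mathcal V$ has decision $x_i\in\mathbb R^m$ and differentiable cost $J_i(x_i,x_{-i}):\mathbb R^{Nm}\to\mathbb R$, where $x_{-i}=(x_1,\dots,x_{i-1},x_{i+1},\dots,x_N)$, and solves $\min_{x_i\in\mathbb R^m}J_i(x_i,x_{-i})$. A profile $x^*=(x_1^*,\dots,x_N^* )$ is a Nash equilibrium if $J_i(x_i^*,x_{-i}^* )\le J_i(x_i,x_{-i}^* )$ for all $x_i\in\mathbb R^m$ and all $i\in\mathcal V$. The pseudo-gradient is $\mathcal F(x)=\big(\nabla_{x_1}J_1(x_1,x_{-1}),\dots,\nabla_{x_N}J_N(x_N,x_{-N})\big)\in\mathbb R^{Nm}$. A map $F$ is $\omega$-strongly monotone if $(x-y)^T(F(x)-F(y))\ge\omega\|x-y\|^2$ for all $x,y$, and $\theta$-Lipschitz if $\|F(x)-F(y)\|\le\theta\|x-y\|$ for all $x,y$. Under hypotheses (3) and (4) the game has exactly one Nash equilibrium. Dynamics. With $n\ge 1$, player $i$ obeys $x_i^{(n)}=f_i(x_i,x_i^{(1)},\dots,x_i^{(n-1)},w_i)+u_i$, where $x_i^{(l)}$ is the $l$th time derivative of $x_i$, $w_i\in\mathbb{R}^{n_{w_i}}$ is an (unknown) constant parameter, $f_i(\cdot,\dots,\cdot,w_i):(\mathbb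 R^m)^n\to\mathbb R^m$, and $u_i\in\mathbb R^m$ is the control input. State-based algorithm. For $i,j\in\mathcal V$, $$u_i=-\sum_{l=1}^{n-1}\varepsilon^{n-l}k_lx_i^{(l)}-\alpha_1\nabla_{x_i}J_i(x_i,\hat x_{-i})-\alpha_2y_i,$$ $$\dot y_i=\sum_{l=1}^{n-1}\varepsilon^{1-l}k_lx_i^{(l)}+\frac{\alpha_1}{\varepsilon^{n-1}}\nabla_{x_i}J_i(x_i,\hat x_{-i}),$$ $$\dot{\hat x}^i_j=-\alpha_3\Big(\sum_{k=1}^Na_{ik}(\hat x^i_j-\hat x^k_j)+a_{ij}(\hat x^i_j-x_j)\Big),$$ where $y_i\in\mathbb R^m$, $\hat x^i_j\in\mathbb R^m$ is player $i$'s estimate of $x_j$, and $\hat x_{-i}=(\hat x_1^i,\dots,\hat x_{i-1}^i,\hat x_{i+1}^i,\dots,\hat x_N^i)$; $\nabla_{x_i}J_i(x_i,\hat x_{-i})$ is the gradient of $J_i$ in its own decision evaluated at $(x_i,\hat x_{-i})$. The closed-loop system has state consisting of all $x_i,x_i^{(1)},\dots,x_i^{(n-1)},y_i,\hat x^i_j$. Empty sums are zero. *)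

theory Defs
  imports "HOL-Analysis.Analysis"
begin

text \<open>
  The finite type \<open>'p\<close> is the set of players, \<open>'m\<close> indexes the coordinates of a single decision.
  A profile in \<open>(real^'m)^'p\<close> carries the Euclidean norm and inner product of the stacked vector.
\<close>

type_synonym ('m, 'p) profile = "(real ^ 'm) ^ 'p"

text \<open>Entry \<open>a $ i $ j\<close> is the weight of the edge along which \<open>i\<close> receives information from \<open>j\<close>,
  so that edge is the pair \<open>(j, i)\<close>.\<close>

definition weighted_digraph :: "real ^ 'p ^ 'p \<Rightarrow> bool" where
  "weighted_digraph a \<longleftrightarrow> (\<forall>i j. 0 \<le> a $ i $ j) \<and> (\<forall>i. a $ i $ i = 0)"

definition digraph_edges :: "real ^ 'p ^ 'p \<Rightarrow> ('p \<times> 'p) set" where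
  "digraph_edges a = {(j, i). 0 < a $ i $ j}"

definition strongly_connected :: "real ^ 'p ^ 'p \<Rightarrow> bool" where
  "strongly_connected a \<longleftrightarrow> (\<forall>i j. (i, j) \<in> (digraph_edges a)\<^sup>*)"

definition replace_decision :: "('m::finite, 'p::finite) profile \<Rightarrow> 'p \<Rightarrow> real ^ 'm \<Rightarrow> ('m, 'p) profile" where
  "replace_decision x i z = (\<chi> j. if j = i then z else x $ j)"

definition nash_equilibrium ::
  "('p \<Rightarrow> ('m::finite, 'p::finite) profile \<Rightarrow> real) \<Rightarrow> ('m, 'p) profile \<Rightarrow> bool" where
  "nash_equilibrium J x \<longleftrightarrow> (\<forall>i z. J i x \<le> J i (replace_decision x i z))"

definition partial_gradient ::
  "('p \<Rightarrow> ('m::finite, 'p::finite) profile \<Rightarrow> real) \<Rightarrow> 'p \<Rightarrow> ('m, 'p) profile \<Rightarrow> real ^ 'm" where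
  "partial_gradient J i x = (THE D. GDERIV (\<lambda>z. J i (replace_decision x i z)) (x $ i) :> D)"

definition pseudo_gradient ::
  "('p \<Rightarrow> ('m::finite, 'p::finite) profile \<Rightarrow> real) \<Rightarrow> ('m, 'p) profile \<Rightarrow> ('m, 'p) profile" where
  "pseudo_gradient J x = (\<chi> i. partial_gradient J i x)"

definition continuously_differentiable :: "('a::real_inner \<Rightarrow> real) \<Rightarrow> bool" where
  "continuously_differentiable g \<longleftrightarrow>
     (\<exists>g'. (\<forall>x. GDERIV g x :> g' x) \<and> continuous_on UNIV g')"

definition strongly_monotone :: "real \<Rightarrow> ('a::real_inner \<Rightarrow> 'a) \<Rightarrow> bool" where
  "strongly_monotone \<omega> F \<longleftrightarrow> (\<forall>x y. (x - y) \<bullet> (F x - F y) \<ge> \<omega> * (norm (x - y))\<^sup>2)"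

text \<open>
  Along a solution, \<open>x l t $ i\<close> is the \<open>l\<close>-th time derivative of the decision of player \<open>i\<close>, for
  \<open>l = 0, \<dots>, n\<close> (values for \<open>l > n\<close> are irrelevant), and \<open>xh t $ i $ j\<close> is the estimate that player
  \<open>i\<close> has of the decision of player \<open>j\<close>.
\<close>

definition estimated_gradient ::
  "('p \<Rightarrow> ('m::finite, 'p::finite) profile \<Rightarrow> real)
   \<Rightarrow> (nat \<Rightarrow> real \<Rightarrow> ('m, 'p) profile) \<Rightarrow> (real \<Rightarrow> ('m, 'p) profile ^ 'p)
   \<Rightarrow> 'p \<Rightarrow> real \<Rightarrow> real ^ 'm" where
  "estimated_gradient J x xh i t = partial_gradient J i (replace_decision (xh t $ i) i (x 0 t $ i))"

definition state_control ::
  "nat \<Rightarrow> ('p \<Rightarrow> ('m::finite, 'p::finite) profile \<Rightarrow> real) \<Rightarrow> (nat \<Rightarrow> real)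
   \<Rightarrow> real \<Rightarrow> real \<Rightarrow> real
   \<Rightarrow> (nat \<Rightarrow> real \<Rightarrow> ('m, 'p) profile) \<Rightarrow> (real \<Rightarrow> ('m, 'p) profile)
   \<Rightarrow> (real \<Rightarrow> ('m, 'p) profile ^ 'p) \<Rightarrow> 'p \<Rightarrow> real \<Rightarrow> real ^ 'm" where
  "state_control n J k \<alpha>\<^sub>1 \<alpha>\<^sub>2 \<epsilon> x y xh i t =
     - (\<Sum>l = 1..<n. (\<epsilon> ^ (n - l) * k l) *\<^sub>R x l t $ i)
     - \<alpha>\<^sub>1 *\<^sub>R estimated_gradient J x xh i t
     - \<alpha>\<^sub>2 *\<^sub>R y t $ i"

text \<open>
  The nonlinearity \<open>f i\<close> takes the list \<open>[x\<^sub>i, x\<^sub>i\<^sup>(\<^sup>1\<^sup>), \<dots>]\<close> of length \<open>n\<close> and the parameter vector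
  \<open>w i\<close>, a list because its dimension may differ between players.
  At time \<open>0\<close> the derivatives are one-sided.
\<close>

definition closed_loop_solution ::
  "nat \<Rightarrow> real ^ 'p ^ 'p \<Rightarrow> ('p \<Rightarrow> ('m::finite, 'p::finite) profile \<Rightarrow> real)
   \<Rightarrow> ('p \<Rightarrow> (real ^ 'm) list \<Rightarrow> real list \<Rightarrow> real ^ 'm) \<Rightarrow> ('p \<Rightarrow> real list) \<Rightarrow> (nat \<Rightarrow> real)
   \<Rightarrow> real \<Rightarrow> real \<Rightarrow> real \<Rightarrow> real
   \<Rightarrow> (nat \<Rightarrow> real \<Rightarrow> ('m, 'p) profile) \<Rightarrow> (real \<Rightarrow> ('m, 'p) profile)
   \<Rightarrow> (real \<Rightarrow> ('m, 'p) profile ^ 'p) \<Rightarrow> bool" where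
  "closed_loop_solution n a J f w k \<alpha>\<^sub>1 \<alpha>\<^sub>2 \<alpha>\<^sub>3 \<epsilon> x y xh \<longleftrightarrow>
     (\<forall>t\<ge>0. \<forall>i.
        (\<forall>l<n. ((\<lambda>s. x l s $ i) has_vector_derivative x (Suc l) t $ i) (at t within {0..})) \<and>
        x n t $ i = f i (map (\<lambda>l. x l t $ i) [0..<n]) (w i)
                    + state_control n J k \<alpha>\<^sub>1 \<alpha>\<^sub>2 \<epsilon> x y xh i t \<and>
        ((\<lambda>s. y s $ i) has_vector_derivative
           (\<Sum>l = 1..<n. (\<epsilon> powi (1 - int l) * k l) *\<^sub>R x l t $ i)
           + (\<alpha>\<^sub>1 / \<epsilon> ^ (n - 1)) *\<^sub>R estimated_gradient J x xh i t) (at t within {0..}) \<and>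
        (\<forall>j. ((\<lambda>s. xh s $ i $ j) has_vector_derivative
           - \<alpha>\<^sub>3 *\<^sub>R ((\<Sum>q\<in>UNIV. a $ i $ q *\<^sub>R (xh t $ i $ j - xh t $ q $ j))
                    + a $ i $ j *\<^sub>R (xh t $ i $ j - x 0 t $ j))) (at t within {0..})))"

end

theory Submission
  imports Defs "HOL-Computational_Algebra.Fundamental_Theorem_Algebra"
begin

text \<open>
  Put \<open>\<xi>\<^sub>0 = x - x_star\<close>, \<open>\<xi>\<^sub>l = x\<^sup>(\<^sup>l\<^sup>) / \<epsilon>\<^sup>l\<close>, let \<open>\<eta>\<close> be the deviation of \<open>y\<close> from its equilibrium value, and
  set \<open>k\<^sub>n = 1\<close>.  With \<open>\<Delta>\<close> the deviation of the nonlinearities and \<open>G\<close> the estimated gradients,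
  the combinations \<open>p = k\<^sub>1 \<xi>\<^sub>0 + \<dots> + k\<^sub>n \<xi>\<^sub>n\<^sub>-\<^sub>1\<close> and \<open>s = \<xi>\<^sub>n\<^sub>-\<^sub>1 + \<eta>\<close> satisfy
  \<open>p' = \<epsilon>\<^sup>1\<^sup>-\<^sup>n (\<Delta> - \<alpha>\<^sub>1 G - \<eta>)\<close> and \<open>s' = \<epsilon>\<^sup>1\<^sup>-\<^sup>n (\<Delta> - \<eta>)\<close>.  Strong monotonicity with a large \<open>\<alpha>\<^sub>1\<close>
  damps \<open>p\<close>, and \<open>s\<close> damps itself with \<open>\<alpha>\<^sub>2 = 1\<close>.  The derivatives \<open>\<xi>\<^sub>1, \<dots>, \<xi>\<^sub>n\<^sub>-\<^sub>1\<close> and the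
  estimation errors form a Hurwitz system on the faster time scale \<open>\<epsilon>\<close>; it is put in triangular
  form by splitting off the roots of the characteristic polynomial one at a time.  Each of these
  modes has an amplitude whose growth is bounded by those of the other modes, so for large \<open>\<epsilon>\<close>,
  \<open>\<alpha>\<^sub>3 = \<epsilon>\<close> and suitable weights the largest weighted amplitude decays exponentially.
\<close>

subsection \<open>Decay of the largest weighted amplitude\<close>

lemma common_rate:
  fixes v m :: "'i \<Rightarrow> real"
  assumes "finite I" "\<And>i. i \<in> I \<Longrightarrow> 0 < v i" "\<And>i. i \<in> I \<Longrightarrow> 0 < m i"
  shows "\<exists>r>0. \<forall>i\<in>I. r * v i < m i"
proof -
  \<comment> \<open>The inserted 1 covers an empty \<open>I\<close>; halving the ratios makes the
    resulting inequality strict.\<close>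
  define r where "r = Min (insert 1 ((\<lambda>i. m i / (2 * v i)) ` I))"
  have pos: "0 < r"
    using assms by (auto simp: r_def)
  have "r * v i < m i" if "i \<in> I" for i
  proof -
    have "r \<le> m i / (2 * v i)"
      using assms(1) that by (auto simp: r_def intro!: Min_le)
    moreover have "m i / (2 * v i) < m i / v i"
      using assms(2,3)[OF that] by (simp add: field_simps)
    ultimately have "r < m i / v i"
      by linarith
    then show ?thesis
      using assms(2)[OF that] by (simp add: field_simps)
  qed
  with pos show ?thesis
    by blast
qed

text \<open>The third premise of the conclusion constrains the derivative of \<open>N i\<close> only at times when \<open>i\<close>
  attains the maximum of the weighted amplitudes, which is all that a first-crossing argument for
  \<open>C * d i * exp (- r * t)\<close> needs.\<close>

lemma vector_lyapunov_decay:
  fixes d m :: "'i \<Rightarrow> real"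
  assumes fin: "finite I" and d: "\<And>i. i \<in> I \<Longrightarrow> 0 < d i" and m: "\<And>i. i \<in> I \<Longrightarrow> 0 < m i"
  obtains r where "r > 0"
    "\<And>N N'. (\<And>i t. i \<in> I \<Longrightarrow> t \<ge> 0 \<Longrightarrow> 0 \<le> N i t) \<Longrightarrow>
      (\<And>i t. i \<in> I \<Longrightarrow> t \<ge> 0 \<Longrightarrow>
         ((\<lambda>t. (N i t)\<^sup>2) has_real_derivative N' i t) (at t within {0..})) \<Longrightarrow>
      (\<And>i t h. i \<in> I \<Longrightarrow> t \<ge> 0 \<Longrightarrow> 0 < h \<Longrightarrow> (\<And>j. j \<in> I \<Longrightarrow> N j t \<le> h * d j) \<Longrightarrow>
         N i t = h * d i \<Longrightarrow> N' i t \<le> - m i * h\<^sup>2) \<Longrightarrow>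
      \<exists>C>0. \<forall>i\<in>I. \<forall>t\<ge>0. N i t \<le> C * d i * exp (- r * t)"
proof -
  obtain r where r: "r > 0" "\<And>i. i \<in> I \<Longrightarrow> r * (2 * (d i)\<^sup>2) < m i"
  proof -
    have "\<exists>r>0. \<forall>i\<in>I. r * (2 * (d i)\<^sup>2) < m i"
    proof (rule common_rate[OF fin _ m])
      show "0 < 2 * (d i)\<^sup>2" if "i \<in> I" for i
        using d[OF that] by simp
    qed
    with that show thesis
      by blast
  qed
  show thesis
  proof (rule that[OF r(1)])
    fix N N' :: "'i \<Rightarrow> real \<Rightarrow> real"
    assume nonneg: "\<And>i t. i \<in> I \<Longrightarrow> t \<ge> 0 \<Longrightarrow> 0 \<le> N i t"
      and deriv: "\<And>i t. i \<in> I \<Longrightarrow> t \<ge> 0 \<Longrightarrow>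
         ((\<lambda>t. (N i t)\<^sup>2) has_real_derivative N' i t) (at t within {0..})"
      and diss: "\<And>i t h. i \<in> I \<Longrightarrow> t \<ge> 0 \<Longrightarrow> 0 < h \<Longrightarrow> (\<And>j. j \<in> I \<Longrightarrow> N j t \<le> h * d j) \<Longrightarrow>
         N i t = h * d i \<Longrightarrow> N' i t \<le> - m i * h\<^sup>2"
    \<comment> \<open>The summand 1 puts all initial values strictly below the envelope.\<close>
    define C where "C = (\<Sum>i\<in>I. N i 0 / d i) + 1"
    have sum_nonneg: "0 \<le> (\<Sum>i\<in>I. N i 0 / d i)"
      using nonneg d by (intro sum_nonneg) (auto simp: less_imp_le)
    then have "C > 0"
      by (simp add: C_def)
    have C0: "N i 0 < C * d i" if "i \<in> I" for i
    proof -
      have "N i 0 / d i \<le> (\<Sum>i\<in>I. N i 0 / d i)"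
        using that fin nonneg d by (intro member_le_sum) (auto simp: less_imp_le)
      then have "N i 0 / d i < C"
        by (simp add: C_def)
      then show ?thesis
        using d[OF that] by (simp add: field_simps)
    qed
    \<comment> \<open>Squares are compared because only \<open>(N i t)\<^sup>2\<close> has a given
      derivative; a norm need not be differentiable at zero.\<close>
    define g where "g i t = (N i t)\<^sup>2 - (C * d i * exp (- r * t))\<^sup>2" for i t
    have g_iff: "g i t < 0 \<longleftrightarrow> N i t < C * d i * exp (- r * t)" if "i \<in> I" "t \<ge> 0" for i t
    proof -
      have "0 \<le> C * d i * exp (- r * t)"
        using d[OF that(1)] \<open>C > 0\<close> by simp
      then show ?thesis
        using nonneg[OF that] power2_less_imp_less[of "N i t"] power_strict_mono[of "N i t" _ 2]
        by (auto simp: g_def)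
    qed
    have g_deriv: "(g i has_real_derivative N' i t + 2 * r * (C * d i * exp (- r * t))\<^sup>2)
        (at t within {0..})" if "i \<in> I" "t \<ge> 0" for i t
    proof -
      have "((\<lambda>t. (C * d i * exp (- r * t))\<^sup>2) has_real_derivative
          - (2 * r * (C * d i * exp (- r * t))\<^sup>2)) (at t within {0..})"
        by (auto intro!: derivative_eq_intros simp: power2_eq_square algebra_simps)
      from DERIV_diff[OF deriv[OF that] this] show ?thesis
        by (simp add: g_def[abs_def])
    qed
    have g_cont: "continuous_on {0..} (g i)" if "i \<in> I" for i
      using g_deriv[OF that] by (intro DERIV_continuous_on) auto
    \<comment> \<open>The times at which some amplitude has reached its envelope. Finiteness of
      \<open>I\<close> and continuity make this set closed, so that its infimum is an actual first
      crossing.\<close>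
    define T where "T = (\<Union>i\<in>I. {t \<in> {0..}. 0 \<le> g i t})"
    have "closed T"
      unfolding T_def
      by (intro closed_UN fin ballI continuous_closed_preimage_constant
            continuous_on_closed_Collect_le[OF continuous_on_const g_cont]) auto
    have "T = {}"
    proof (rule ccontr)
      assume "T \<noteq> {}"
      have bdd: "bdd_below T"
        by (rule bdd_belowI[of _ 0]) (auto simp: T_def)
      define u where "u = Inf T"
      have "u \<in> T"
        unfolding u_def using \<open>T \<noteq> {}\<close> bdd \<open>closed T\<close> by (rule closed_contains_Inf)
      then obtain i where i: "i \<in> I" "0 \<le> g i u" and u0: "u \<ge> 0"
        by (auto simp: T_def)
      have before: "g j t < 0" if "j \<in> I" "0 \<le> t" "t < u" for j t
      proof (rule ccontr)
        assume "\<not> g j t < 0"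
        then have "t \<in> T"
          using that by (auto simp: T_def not_less)
        then have "u \<le> t"
          unfolding u_def using bdd by (rule cInf_lower)
        then show False
          using that by simp
      qed
      have "g i 0 < 0"
        using C0 g_iff[of i 0] i(1) by simp
      then have "u > 0"
        using i u0 by (cases "u = 0") auto
      have le0: "g j u \<le> 0" if "j \<in> I" for j
      proof -
        have "(g j \<longlongrightarrow> g j u) (at u within {0..})"
          using g_cont[OF that] u0 by (auto simp: continuous_on_def)
        then have "(g j \<longlongrightarrow> g j u) (at u within {0..<u})"
          by (rule tendsto_within_subset) auto
        moreover have "at u within {0..<u} \<noteq> bot"
          using \<open>u > 0\<close> by (simp add: trivial_limit_within islimpt_Ico)
        moreover have "eventually (\<lambda>t. g j t \<le> 0) (at u within {0..<u})"
          using before[OF that] by (auto simp: eventually_at_filter less_imp_le intro!: always_eventually)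
        ultimately show ?thesis
          by (intro tendsto_upperbound[of "g j" _ "at u within {0..<u}"])
      qed
      \<comment> \<open>At the crossing every amplitude is at most \<open>h * d j\<close>, with
        equality for \<open>i\<close>; this is the situation covered by \<open>diss\<close>.\<close>
      define h where "h = C * exp (- r * u)"
      have "h > 0"
        using \<open>C > 0\<close> by (simp add: h_def)
      have le: "N j u \<le> h * d j" if "j \<in> I" for j
      proof -
        have "(N j u)\<^sup>2 \<le> (h * d j)\<^sup>2"
          using le0[OF that] by (simp add: g_def h_def mult_ac)
        then show ?thesis
          by (rule power2_le_imp_le) (use d[OF that] \<open>h > 0\<close> in simp)
      qed
      have eq: "N i u = h * d i"
      proof -
        have "\<not> N i u < h * d i"
          using g_iff[OF i(1) u0] i(2) by (simp add: h_def mult_ac)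
        then show ?thesis
          using le[OF i(1)] by simp
      qed
      have "N' i u \<le> - m i * h\<^sup>2"
        using diss[OF i(1) u0 \<open>h > 0\<close> le eq] .
      moreover have "r * (2 * (d i)\<^sup>2) * h\<^sup>2 < m i * h\<^sup>2"
        using r(2)[OF i(1)] \<open>h > 0\<close> by (simp add: mult_strict_right_mono)
      ultimately have "N' i u + 2 * r * (h * d i)\<^sup>2 < 0"
        by (simp add: power_mult_distrib mult_ac)
      then have neg: "N' i u + 2 * r * (C * d i * exp (- r * u))\<^sup>2 < 0"
        by (simp add: h_def mult_ac)
      \<comment> \<open>A negative derivative makes \<open>g i\<close> larger just before
        \<open>u\<close>, although it is negative there and nonnegative at \<open>u\<close>.\<close>
      obtain e where e: "e > 0" "\<And>z. z > 0 \<Longrightarrow> u - z \<in> {0..} \<Longrightarrow> z < e \<Longrightarrow> g i u < g i (u - z)"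
        using has_real_derivative_neg_dec_left[OF g_deriv[OF i(1) u0] neg] by blast
      define z where "z = min (e / 2) u"
      have "z > 0" "z < e" "z \<le> u"
        using \<open>e > 0\<close> \<open>u > 0\<close> by (auto simp: z_def)
      then have "g i u < g i (u - z)" "g i (u - z) < 0"
        using e(2)[of z] before[of i "u - z"] i(1) by auto
      then show False
        using i(2) by simp
    qed
    have "N i t \<le> C * d i * exp (- r * t)" if "i \<in> I" "t \<ge> 0" for i t
    proof -
      have "g i t < 0"
        using \<open>T = {}\<close> that by (force simp: T_def)
      then show ?thesis
        using g_iff[OF that] by simp
    qed
    with \<open>C > 0\<close> show "\<exists>C>0. \<forall>i\<in>I. \<forall>t\<ge>0. N i t \<le> C * d i * exp (- r * t)"
      by blast
  qed
qed


subsection \<open>Weights for the estimation errors\<close>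

text \<open>Take \<open>d i j = 1 - \<eta> ^ h\<close> for a small \<open>\<eta>\<close>, where \<open>h\<close> is the least length of a nonempty walk from
  \<open>j\<close> to \<open>i\<close>: the gain along the last edge of a shortest walk dominates all losses. A second vertex
  is needed for a closed walk through \<open>j\<close> to exist.\<close>

lemma strongly_connected_weights:
  fixes a :: "real ^ 'p::finite ^ 'p"
  assumes wd: "weighted_digraph a" and sc: "strongly_connected a" and two: "i\<^sub>0 \<noteq> (j\<^sub>0::'p)"
  obtains d :: "'p \<Rightarrow> 'p \<Rightarrow> real" and m where "m > 0" "\<And>i j. 0 < d i j"
    "\<And>i j. m \<le> (\<Sum>q\<in>UNIV. a $ i $ q * (d i j - d q j)) + a $ i $ j * d i j"
proof -
  define E where "E = digraph_edges a"
  have a0: "0 \<le> a $ i $ j" for i j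
    using wd by (simp add: weighted_digraph_def)
  have E_iff: "(j, i) \<in> E \<longleftrightarrow> 0 < a $ i $ j" for i j
    by (simp add: E_def digraph_edges_def)
  have reach: "(j, i) \<in> E\<^sup>*" for i j
    using sc by (simp add: strongly_connected_def E_def)
  have walk: "\<exists>l\<ge>1. (j, i) \<in> E ^^ l" for i j
  proof -
    have "(j, i) \<in> E\<^sup>+"
    proof (cases "j = i")
      case True
      obtain k where "k \<noteq> i"
        using two by metis
      then have "(i, k) \<in> E\<^sup>+" "(k, i) \<in> E\<^sup>+"
        using reach[of i k] reach[of k i] by (auto simp: rtrancl_eq_or_trancl)
      then show ?thesis
        using True by (blast intro: trancl_trans)
    next
      case False
      then show ?thesis
        using reach[of j i] by (auto simp: rtrancl_eq_or_trancl)
    qed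
    then show ?thesis
      by (auto simp: trancl_power Suc_le_eq)
  qed
  define h where "h i j = (LEAST l. 1 \<le> l \<and> (j, i) \<in> E ^^ l)" for i j
  have h: "1 \<le> h i j" "(j, i) \<in> E ^^ h i j" for i j
    using LeastI_ex[OF walk[of j i, unfolded Bex_def]] by (auto simp: h_def)
  have h_le: "h i j \<le> l" if "1 \<le> l" "(j, i) \<in> E ^^ l" for i j l
    using that by (auto simp: h_def intro: Least_le)
  define A where "A = 1 + (\<Sum>i\<in>UNIV. \<Sum>q\<in>UNIV. a $ i $ q)"
  have A_row: "(\<Sum>q\<in>UNIV. a $ i $ q) + 1 \<le> A" for i
  proof -
    have "(\<Sum>q\<in>UNIV. a $ i $ q) \<le> (\<Sum>i\<in>UNIV. \<Sum>q\<in>UNIV. a $ i $ q)"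
      by (rule member_le_sum[of i UNIV "\<lambda>i. \<Sum>q\<in>UNIV. a $ i $ q"]) (auto intro: sum_nonneg a0)
    then show ?thesis
      by (simp add: A_def)
  qed
  have "A \<ge> 1"
    by (simp add: A_def sum_nonneg a0)
  define b where "b = Min (insert 1 {a $ i $ q | i q. 0 < a $ i $ q})"
  have fin: "finite {a $ i $ q | i q. 0 < a $ i $ q}"
    by (rule finite_subset[of _ "(\<lambda>(i, q). a $ i $ q) ` UNIV"]) auto
  have b: "0 < b" "b \<le> 1" "\<And>i q. 0 < a $ i $ q \<Longrightarrow> b \<le> a $ i $ q"
    using fin by (auto simp: b_def intro!: Min_le)
  \<comment> \<open>With \<open>A * \<eta> = b / 4\<close> the losses total at most
    \<open>b / 4 * \<eta> ^ l\<close>, where \<open>l\<close> is the walk length without its last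
    edge. The gain is at least \<open>3 / 4 * b * \<eta> ^ l\<close>, which leaves
    \<open>b / 2 * \<eta> ^ l\<close>.\<close>
  define \<eta> where "\<eta> = b / (4 * A)"
  have eta: "0 < \<eta>" "\<eta> \<le> 1 / 4" "A * \<eta> = b / 4"
    using b \<open>A \<ge> 1\<close> by (auto simp: \<eta>_def field_simps)
  define H where "H = (\<Sum>i\<in>UNIV. \<Sum>j\<in>UNIV. h i j)"
  have h_H: "h i j \<le> H" for i j
  proof -
    have "h i j \<le> (\<Sum>j\<in>UNIV. h i j)"
      by (rule member_le_sum) auto
    also have "\<dots> \<le> H"
      unfolding H_def by (rule member_le_sum[of i UNIV "\<lambda>i. \<Sum>j\<in>UNIV. h i j"]) auto
    finally show ?thesis .
  qed
  define d where "d i j = 1 - \<eta> ^ h i j" for i j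
  have eta_le: "\<eta> ^ h i j \<le> \<eta>" for i j
    using power_decreasing[of 1 "h i j" \<eta>] h(1)[of i j] eta by simp
  show thesis
  proof (rule that)
    show "0 < b / 2 * \<eta> ^ H"
      using b eta by simp
    show "0 < d i j" for i j
      using eta_le[of i j] eta by (simp add: d_def)
    show "b / 2 * \<eta> ^ H \<le> (\<Sum>q\<in>UNIV. a $ i $ q * (d i j - d q j)) + a $ i $ j * d i j" for i j
    proof -
      have gap: "- (\<eta> ^ h i j) \<le> d i j - d q j" for q
        using eta by (simp add: d_def)
      \<comment> \<open>The set \<open>S\<close> is \<open>UNIV\<close> if the gain is the separate
        term \<open>a $ i $ j * d i j\<close>, and \<open>UNIV - {k}\<close> if it is the summand of
        \<open>k\<close>.\<close>
      have all: "(\<Sum>q\<in>S. a $ i $ q * (d i j - d q j)) \<ge> - (A * \<eta> ^ h i j)" for S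
      proof -
        have "(\<Sum>q\<in>S. a $ i $ q * (d i j - d q j)) \<ge> (\<Sum>q\<in>S. a $ i $ q * (- (\<eta> ^ h i j)))"
          by (intro sum_mono mult_left_mono gap a0)
        moreover have "(\<Sum>q\<in>S. a $ i $ q * (- (\<eta> ^ h i j))) = - ((\<Sum>q\<in>S. a $ i $ q) * \<eta> ^ h i j)"
          by (simp add: sum_distrib_right sum_negf)
        moreover have "(\<Sum>q\<in>S. a $ i $ q) \<le> A"
          using A_row[of i] sum_mono2[of UNIV S "\<lambda>q. a $ i $ q"] a0 by simp
        then have "(\<Sum>q\<in>S. a $ i $ q) * \<eta> ^ h i j \<le> A * \<eta> ^ h i j"
          using eta by (intro mult_right_mono) auto
        ultimately show ?thesis
          by linarith
      qed
      obtain l where l: "h i j = Suc l"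
        using h(1)[of i j] by (cases "h i j") auto
      have Aeq: "A * \<eta> ^ h i j = b / 4 * \<eta> ^ l"
        using eta(3) by (simp add: l algebra_simps)
      have "b / 2 * \<eta> ^ H \<le> b / 2 * \<eta> ^ l"
        using h_H[of i j] eta b by (intro mult_left_mono power_decreasing) (auto simp: l)
      \<comment> \<open>For \<open>l = 0\<close> there is an edge from \<open>j\<close> to
        \<open>i\<close>. Otherwise the predecessor \<open>k\<close> of \<open>i\<close> on a
        shortest walk has a smaller distance from \<open>j\<close>, hence a weight below
        \<open>d i j\<close>.\<close>
      moreover have "b / 2 * \<eta> ^ l \<le> (\<Sum>q\<in>UNIV. a $ i $ q * (d i j - d q j)) + a $ i $ j * d i j"
      proof (cases l)
        case 0
        then have "0 < a $ i $ j"
          using h(2)[of j i] by (simp add: l E_iff)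
        moreover have "3 / 4 \<le> d i j"
          using eta eta_le[of i j] by (simp add: d_def)
        ultimately have "b * (3 / 4) \<le> a $ i $ j * d i j"
          using b by (intro mult_mono) auto
        then show ?thesis
          using all[of UNIV] 0 unfolding Aeq by simp
      next
        case (Suc l')
        then obtain k where k: "(j, k) \<in> E ^^ l" "(k, i) \<in> E"
          using h(2)[of j i] by (auto simp: l)
        have "h k j \<le> l"
          using k Suc by (intro h_le) auto
        then have "\<eta> ^ l \<le> \<eta> ^ h k j"
          using eta by (intro power_decreasing) auto
        moreover have "\<eta> * \<eta> ^ l \<le> 1 / 4 * \<eta> ^ l"
          using eta by (intro mult_right_mono) auto
        ultimately have "3 / 4 * \<eta> ^ l \<le> d i j - d k j"
          by (simp add: d_def l)
        moreover have "b \<le> a $ i $ k"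
          using k(2) b(3) by (simp add: E_iff)
        ultimately have "b * (3 / 4 * \<eta> ^ l) \<le> a $ i $ k * (d i j - d k j)"
          using b eta by (intro mult_mono) auto
        moreover have "(\<Sum>q\<in>UNIV. a $ i $ q * (d i j - d q j)) =
            a $ i $ k * (d i j - d k j) + (\<Sum>q\<in>UNIV - {k}. a $ i $ q * (d i j - d q j))"
          by (rule sum.remove) auto
        moreover have "0 \<le> a $ i $ j * d i j"
          using a0 \<open>\<And>i j. 0 < d i j\<close> by (simp add: less_imp_le)
        ultimately show ?thesis
          using all[of "UNIV - {k}"] unfolding Aeq by simp
      qed
      ultimately show ?thesis
        by linarith
    qed
  qed
qed


subsection \<open>Nash equilibria as zeros of the pseudo-gradient\<close>

lemma replace_decision_nth [simp]: "replace_decision x i z $ j = (if j = i then z else x $ j)"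
  by (simp add: replace_decision_def)

lemma replace_decision_same [simp]: "replace_decision x i (x $ i) = x"
  by (simp add: vec_eq_iff)

lemma GDERIV_unique:
  assumes "GDERIV f x :> D" "GDERIV f x :> D'"
  shows "D = D'"
proof -
  have "(\<lambda>h. h \<bullet> D) = (\<lambda>h. h \<bullet> D')"
    using assms by (auto simp: gderiv_def intro: has_derivative_unique)
  then have "(D - D') \<bullet> D = (D - D') \<bullet> D'"
    by (rule fun_cong)
  then have "(D - D') \<bullet> (D - D') = 0"
    by (simp add: inner_diff_right)
  then show ?thesis
    by simp
qed

lemma bounded_linear_axis: "bounded_linear (axis i :: 'a::euclidean_space \<Rightarrow> 'a ^ 'n::finite)"
proof -
  have "linear (axis i :: 'a \<Rightarrow> 'a ^ 'n)"
    by (rule linearI) (auto simp: axis_def vec_eq_iff)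
  then show ?thesis
    by (simp add: linear_conv_bounded_linear)
qed

lemma has_derivative_replace_decision:
  "(replace_decision x i has_derivative axis i) (at z)"
proof -
  have "((\<lambda>z. replace_decision x i 0 + axis i z) has_derivative (\<lambda>h. 0 + axis i h)) (at z)"
    by (intro has_derivative_add has_derivative_const bounded_linear_imp_has_derivative bounded_linear_axis)
  moreover have "replace_decision x i = (\<lambda>z. replace_decision x i 0 + axis i z)"
    by (auto simp: fun_eq_iff vec_eq_iff axis_def)
  ultimately show ?thesis
    by simp
qed

text \<open>By the chain rule along the affine map \<open>replace_decision x i\<close>, the partial
  gradient is block \<open>i\<close> of the full gradient; uniqueness of gradients resolves the
  definite description.\<close>

lemma GDERIV_partial_gradient:
  assumes "continuously_differentiable (J i)"
  shows "GDERIV (\<lambda>z. J i (replace_decision x i z)) z :> partial_gradient J i (replace_decision x i z)"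
proof -
  obtain g' where g': "\<And>x. GDERIV (J i) x :> g' x"
    using assms by (auto simp: continuously_differentiable_def)
  have *: "GDERIV (\<lambda>z. J i (replace_decision x i z)) z :> g' (replace_decision x i z) $ i" for x z
  proof -
    have "((\<lambda>z. J i (replace_decision x i z)) has_derivative
        (\<lambda>h. axis i h \<bullet> g' (replace_decision x i z))) (at z)"
      using has_derivative_compose[OF has_derivative_replace_decision
          g'[of "replace_decision x i z", unfolded gderiv_def]] by simp
    moreover have "axis i h \<bullet> v = h \<bullet> v $ i" for h :: "real ^ 'a" and v
      by (simp add: inner_axis inner_commute)
    ultimately show ?thesis
      by (simp add: gderiv_def)
  qed
  have "partial_gradient J i y = g' y $ i" for y
    unfolding partial_gradient_def
    using *[of y "y $ i"] by (intro the_equality) (auto intro: GDERIV_unique)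
  then show ?thesis
    using *[of x z] by simp
qed

text \<open>On the line through \<open>x\<close> and \<open>z\<close> the function is convex in one
  variable and lies above its horizontal tangent at \<open>x\<close>.\<close>

lemma convex_critical_point_minimal:
  fixes g :: "'a::real_inner \<Rightarrow> real"
  assumes convex: "convex_on UNIV g" and crit: "GDERIV g x :> 0"
  shows "g x \<le> g z"
proof -
  define \<phi> where "\<phi> s = g (x + s *\<^sub>R (z - x))" for s
  have "convex_on UNIV \<phi>"
  proof (rule convex_onI)
    fix t u v :: real
    assume t: "0 < t" "t < 1"
    have "x + ((1 - t) *\<^sub>R u + t *\<^sub>R v) *\<^sub>R (z - x)
        = (1 - t) *\<^sub>R (x + u *\<^sub>R (z - x)) + t *\<^sub>R (x + v *\<^sub>R (z - x))"
      by (simp add: algebra_simps)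
    then show "\<phi> ((1 - t) *\<^sub>R u + t *\<^sub>R v) \<le> (1 - t) * \<phi> u + t * \<phi> v"
      using convex_onD[OF convex, of t "x + u *\<^sub>R (z - x)" "x + v *\<^sub>R (z - x)"] t
      by (simp add: \<phi>_def)
  qed auto
  moreover have "(\<phi> has_field_derivative 0) (at 0)"
  proof -
    have "((\<lambda>s. x + s *\<^sub>R (z - x)) has_derivative (\<lambda>s. s *\<^sub>R (z - x))) (at 0)"
      by (auto intro!: derivative_eq_intros)
    moreover have "(g has_derivative (\<lambda>h. 0)) (at (x + 0 *\<^sub>R (z - x)))"
      using crit by (simp add: gderiv_def)
    ultimately have "((\<lambda>s. g (x + s *\<^sub>R (z - x))) has_derivative (\<lambda>s. 0)) (at 0)"
      by (rule has_derivative_compose)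
    then show ?thesis
      by (simp add: \<phi>_def[abs_def] has_field_derivative_def lambda_zero)
  qed
  ultimately have "\<phi> 1 - \<phi> 0 \<ge> 0 * (1 - 0)"
    by (intro convex_on_imp_above_tangent[where A = UNIV]) auto
  then show ?thesis
    by (simp add: \<phi>_def)
qed

text \<open>The first-order condition, player by player: Fermat's rule in one direction, convexity
  in the own decision in the other.\<close>

lemma nash_equilibrium_iff:
  assumes diff: "\<And>i. continuously_differentiable (J i)"
    and convex: "\<And>i x. convex_on UNIV (\<lambda>z. J i (replace_decision x i z))"
  shows "nash_equilibrium J x \<longleftrightarrow> pseudo_gradient J x = 0"
proof -
  have grad: "GDERIV (\<lambda>z. J i (replace_decision x i z)) (x $ i) :> partial_gradient J i x" for i
    using GDERIV_partial_gradient[where J = J and i = i and x = x and z = "x $ i", OF diff] by simp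
  have "(\<forall>z. J i x \<le> J i (replace_decision x i z)) \<longleftrightarrow> partial_gradient J i x = 0" for i
  proof
    assume min: "\<forall>z. J i x \<le> J i (replace_decision x i z)"
    have "(\<lambda>h. h \<bullet> partial_gradient J i x) = (\<lambda>h. 0)"
      by (rule has_derivative_local_min[OF grad[unfolded gderiv_def]])
        (use min in \<open>auto intro: always_eventually\<close>)
    then have "partial_gradient J i x \<bullet> partial_gradient J i x = 0"
      by (rule fun_cong)
    then show "partial_gradient J i x = 0"
      by simp
  next
    assume "partial_gradient J i x = 0"
    then have crit: "GDERIV (\<lambda>z. J i (replace_decision x i z)) (x $ i) :> 0"
      using grad[of i] by simp
    show "\<forall>z. J i x \<le> J i (replace_decision x i z)"
      using convex_critical_point_minimal[OF convex crit] by simp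
  qed
  then show ?thesis
    by (simp add: nash_equilibrium_def pseudo_gradient_def vec_eq_iff)
qed

text \<open>For \<open>\<gamma> = \<omega> / (\<theta>\<^sup>2 + \<omega>\<^sup>2)\<close> the map \<open>x - \<gamma> F x\<close> is a contraction, whatever the
  relation between \<open>\<omega>\<close> and \<open>\<theta>\<close>.\<close>

lemma strongly_monotone_unique_zero:
  fixes F :: "'a::{real_inner, complete_space} \<Rightarrow> 'a"
  assumes "\<omega> > 0" "\<theta> > 0" and mono: "strongly_monotone \<omega> F" and lip: "\<theta>-lipschitz_on UNIV F"
  shows "\<exists>!x. F x = 0"
proof -
  define S where "S = \<theta>\<^sup>2 + \<omega>\<^sup>2"
  have "S > 0"
    using assms by (simp add: S_def add_pos_pos)
  define \<gamma> where "\<gamma> = \<omega> / S"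
  have "\<gamma> > 0"
    using \<open>S > 0\<close> \<open>\<omega> > 0\<close> by (simp add: \<gamma>_def)
  define c where "c = sqrt (\<theta>\<^sup>2 / S)"
  have "\<theta>\<^sup>2 < S"
    using \<open>\<omega> > 0\<close> by (simp add: S_def)
  then have c: "0 \<le> c" "c < 1" "c\<^sup>2 = \<theta>\<^sup>2 / S"
    using \<open>S > 0\<close> by (auto simp: c_def)
  define T where "T x = x - \<gamma> *\<^sub>R F x" for x
  have "dist (T x) (T y) \<le> c * dist x y" for x y
  proof -
    let ?u = "x - y" and ?v = "F x - F y"
    have v: "(norm ?v)\<^sup>2 \<le> \<theta>\<^sup>2 * (norm ?u)\<^sup>2"
      using lipschitz_onD[OF lip, of x y]
      by (simp add: dist_norm power_mono flip: power_mult_distrib)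
    have "(norm (T x - T y))\<^sup>2 = (norm (?u - \<gamma> *\<^sub>R ?v))\<^sup>2"
      by (simp add: T_def algebra_simps)
    also have "\<dots> = (norm ?u)\<^sup>2 - 2 * \<gamma> * (?u \<bullet> ?v) + \<gamma>\<^sup>2 * (norm ?v)\<^sup>2"
      unfolding power2_norm_eq_inner
      by (simp add: inner_diff_left inner_diff_right inner_commute power2_eq_square algebra_simps)
    also have "\<dots> \<le> (norm ?u)\<^sup>2 - 2 * \<gamma> * (\<omega> * (norm ?u)\<^sup>2) + \<gamma>\<^sup>2 * (\<theta>\<^sup>2 * (norm ?u)\<^sup>2)"
      using mono \<open>\<gamma> > 0\<close> v
      by (intro add_mono diff_mono mult_left_mono) (auto simp: strongly_monotone_def)
    also have "\<dots> = (1 - 2 * \<gamma> * \<omega> + \<gamma>\<^sup>2 * \<theta>\<^sup>2) * (norm ?u)\<^sup>2"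
      by (simp add: algebra_simps)
    also have "\<dots> \<le> c\<^sup>2 * (norm ?u)\<^sup>2"
    proof (rule mult_right_mono)
      \<comment> \<open>Since \<open>\<gamma> * S = \<omega>\<close>, replacing
        \<open>\<theta>\<^sup>2\<close> by \<open>S\<close> bounds the factor by
        \<open>1 - \<gamma> * \<omega>\<close>, which equals
        \<open>\<theta>\<^sup>2 / S\<close>.\<close>
      have "\<gamma>\<^sup>2 * \<theta>\<^sup>2 \<le> \<gamma>\<^sup>2 * S"
        by (intro mult_left_mono) (auto simp: S_def)
      also have "\<dots> = \<gamma> * \<omega>"
        using \<open>S > 0\<close> by (simp add: \<gamma>_def power2_eq_square)
      finally have "1 - 2 * \<gamma> * \<omega> + \<gamma>\<^sup>2 * \<theta>\<^sup>2 \<le> 1 - \<gamma> * \<omega>"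
        by simp
      also have "\<dots> = c\<^sup>2"
        using \<open>S > 0\<close> by (simp add: c(3) \<gamma>_def field_simps) (simp add: S_def power2_eq_square)
      finally show "1 - 2 * \<gamma> * \<omega> + \<gamma>\<^sup>2 * \<theta>\<^sup>2 \<le> c\<^sup>2" .
    qed simp
    finally have "(norm (T x - T y))\<^sup>2 \<le> (c * norm ?u)\<^sup>2"
      by (simp add: power_mult_distrib)
    then have "norm (T x - T y) \<le> c * norm ?u"
      by (rule power2_le_imp_le) (use c(1) in simp)
    then show ?thesis
      by (simp add: dist_norm)
  qed
  then have "\<exists>!x. T x = x"
    using c by (intro banach_fix_type) auto
  moreover have "T x = x \<longleftrightarrow> F x = 0" for x
    using \<open>\<gamma> > 0\<close> by (simp add: T_def)
  ultimately show ?thesis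
    by simp
qed

text \<open>Each player evaluates its gradient at its own estimated profile, so the Lipschitz bound
  is needed for single blocks.\<close>

lemma norm_partial_gradient_diff_le:
  assumes "\<theta>-lipschitz_on UNIV (pseudo_gradient J)"
  shows "norm (partial_gradient J i x - partial_gradient J i z) \<le> \<theta> * norm (x - z)"
proof -
  have "norm (partial_gradient J i x - partial_gradient J i z)
      = norm ((pseudo_gradient J x - pseudo_gradient J z) $ i)"
    by (simp add: pseudo_gradient_def)
  also have "\<dots> \<le> norm (pseudo_gradient J x - pseudo_gradient J z)"
    by (rule Finite_Cartesian_Product.norm_nth_le)
  also have "\<dots> \<le> \<theta> * norm (x - z)"
    using lipschitz_onD[OF assms, of x z] by (simp add: dist_norm)
  finally show ?thesis .
qed


subsection \<open>Cascade form of a scalar linear equation\<close>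

text \<open>Entry \<open>l\<close> of the \<open>j\<close>-th sequence is \<open>(D - \<rho> (j - 1)) \<dots> (D - \<rho> 0) \<xi> l\<close>, where \<open>D\<close> is the shift; along a
  solution \<open>D\<close> is differentiation.\<close>

primrec cascade :: "(nat \<Rightarrow> complex) \<Rightarrow> (nat \<Rightarrow> complex) \<Rightarrow> nat \<Rightarrow> nat \<Rightarrow> complex" where
  "cascade \<rho> \<xi> 0 l = \<xi> l"
| "cascade \<rho> \<xi> (Suc j) l = cascade \<rho> \<xi> j (Suc l) - \<rho> j * cascade \<rho> \<xi> j l"

text \<open>Each cascade step multiplies the polynomial acting through the shift by one more linear
  factor.\<close>

lemma cascade_eq_sum:
  "cascade \<rho> \<xi> j l = (\<Sum>i\<le>j. coeff (\<Prod>i<j. [:- \<rho> i, 1:]) i * \<xi> (l + i))"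
proof (induction j arbitrary: l)
  case (Suc j)
  let ?q = "\<Prod>i<j. [:- \<rho> i, 1:]"
  have deg: "degree ?q = j"
    by (subst degree_prod_eq_sum_degree) auto
  have q: "(\<Prod>i<Suc j. [:- \<rho> i, 1:]) = pCons 0 ?q - smult (\<rho> j) ?q"
    by (simp add: mult.commute)
  have "(\<Sum>i\<le>Suc j. coeff (pCons 0 ?q - smult (\<rho> j) ?q) i * \<xi> (l + i))
      = (\<Sum>i\<le>Suc j. coeff (pCons 0 ?q) i * \<xi> (l + i)) - \<rho> j * (\<Sum>i\<le>Suc j. coeff ?q i * \<xi> (l + i))"
    by (simp add: algebra_simps sum_subtractf sum_distrib_left)
  also have "(\<Sum>i\<le>Suc j. coeff (pCons 0 ?q) i * \<xi> (l + i)) = (\<Sum>i\<le>j. coeff ?q i * \<xi> (Suc l + i))"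
    by (simp add: sum.atMost_Suc_shift del: sum.atMost_Suc)
  also have "(\<Sum>i\<le>Suc j. coeff ?q i * \<xi> (l + i)) = (\<Sum>i\<le>j. coeff ?q i * \<xi> (l + i))"
    using deg by (simp add: coeff_eq_0)
  finally show ?case
    unfolding q by (simp add: Suc.IH)
qed simp

text \<open>The recursion, solved for \<open>cascade \<rho> \<xi> j (Suc l)\<close>, lowers the
  entry index at the cost of a higher cascade index. The constant is uniform in
  \<open>\<xi>\<close>, so derivatives can later be recovered from the entries at 1.\<close>

lemma cascade_bound:
  "\<exists>B\<ge>0. \<forall>\<xi>. norm (cascade \<rho> \<xi> j (Suc l)) \<le> B * (\<Sum>i\<le>j + l. norm (cascade \<rho> \<xi> i 1))"
proof (induction l arbitrary: j)
  case 0
  have "norm (cascade \<rho> \<xi> j (Suc 0)) \<le> 1 * (\<Sum>i\<le>j + 0. norm (cascade \<rho> \<xi> i 1))" for \<xi>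
    using member_le_sum[of j "{..j}" "\<lambda>i. norm (cascade \<rho> \<xi> i 1)"] by simp
  then show ?case
    using zero_le_one by blast
next
  case (Suc l)
  obtain B1 where B1: "B1 \<ge> 0" "\<And>\<xi>. norm (cascade \<rho> \<xi> (Suc j) (Suc l))
      \<le> B1 * (\<Sum>i\<le>Suc j + l. norm (cascade \<rho> \<xi> i 1))"
    using Suc.IH by blast
  obtain B2 where B2: "B2 \<ge> 0" "\<And>\<xi>. norm (cascade \<rho> \<xi> j (Suc l))
      \<le> B2 * (\<Sum>i\<le>j + l. norm (cascade \<rho> \<xi> i 1))"
    using Suc.IH by blast
  have "norm (cascade \<rho> \<xi> j (Suc (Suc l)))
      \<le> (B1 + norm (\<rho> j) * B2) * (\<Sum>i\<le>j + Suc l. norm (cascade \<rho> \<xi> i 1))" for \<xi>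
  proof -
    let ?S = "\<lambda>k. \<Sum>i\<le>k. norm (cascade \<rho> \<xi> i 1)"
    have "cascade \<rho> \<xi> j (Suc (Suc l)) = cascade \<rho> \<xi> (Suc j) (Suc l) + \<rho> j * cascade \<rho> \<xi> j (Suc l)"
      by simp
    then have "norm (cascade \<rho> \<xi> j (Suc (Suc l)))
        \<le> norm (cascade \<rho> \<xi> (Suc j) (Suc l)) + norm (\<rho> j) * norm (cascade \<rho> \<xi> j (Suc l))"
      by (metis norm_triangle_ineq norm_mult)
    also have "\<dots> \<le> B1 * ?S (j + Suc l) + norm (\<rho> j) * (B2 * ?S (j + l))"
      using B1(2)[of \<xi>] B2(2)[of \<xi>] by (intro add_mono mult_left_mono) (auto simp del: cascade.simps)
    also have "\<dots> \<le> B1 * ?S (j + Suc l) + norm (\<rho> j) * (B2 * ?S (j + Suc l))"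
      using B2(1) by (intro add_mono mult_left_mono order_refl sum_mono2) auto
    finally show ?thesis
      by (simp add: algebra_simps)
  qed
  moreover have "B1 + norm (\<rho> j) * B2 \<ge> 0"
    using B1(1) B2(1) by simp
  ultimately show ?case
    by blast
qed

text \<open>A cascade is a combination of shifts with constant coefficients and so commutes with
  differentiation; it involves the entries \<open>l\<close> to \<open>j + l\<close> only.\<close>

lemma has_vector_derivative_cascade:
  assumes "\<And>l. l < n \<Longrightarrow> ((\<lambda>t. \<xi> t l) has_vector_derivative \<epsilon> *\<^sub>R \<xi> t (Suc l)) (at t within S)"
    and "j + l < n"
  shows "((\<lambda>t. cascade \<rho> (\<xi> t) j l) has_vector_derivative \<epsilon> *\<^sub>R cascade \<rho> (\<xi> t) j (Suc l)) (at t within S)"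
  using assms(2)
proof (induction j arbitrary: l)
  case 0
  then show ?case
    using assms(1) by simp
next
  case (Suc j)
  have "((\<lambda>t. cascade \<rho> (\<xi> t) j (Suc l) - \<rho> j * cascade \<rho> (\<xi> t) j l) has_vector_derivative
      \<epsilon> *\<^sub>R cascade \<rho> (\<xi> t) j (Suc (Suc l)) - \<rho> j * (\<epsilon> *\<^sub>R cascade \<rho> (\<xi> t) j (Suc l))) (at t within S)"
    using Suc.prems by (intro has_vector_derivative_diff has_vector_derivative_mult_right Suc.IH) auto
  then show ?case
    by (simp add: scaleR_diff_right)
qed

text \<open>Appends the leading coefficient 1, so that the characteristic polynomial has coefficient
  \<open>char_coeffs n k (Suc l)\<close> at degree \<open>l\<close>.\<close>

definition char_coeffs :: "nat \<Rightarrow> (nat \<Rightarrow> real) \<Rightarrow> nat \<Rightarrow> real" where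
  "char_coeffs n k l = (if l = n then 1 else k l)"

text \<open>Factor the characteristic polynomial over the complex numbers: the cascade through all
  its roots applies the whole polynomial in the shift.\<close>

lemma hurwitz_roots:
  assumes n: "n \<ge> 1"
    and hurwitz: "\<And>s::complex. s ^ (n - 1) + (\<Sum>l = 1..<n. of_real (k l) * s ^ (l - 1)) = 0 \<Longrightarrow> Re s < 0"
  obtains \<rho> where "\<And>j. j < n - 1 \<Longrightarrow> Re (\<rho> j) < 0"
    "\<And>\<xi>. cascade \<rho> \<xi> (n - 1) 1 = (\<Sum>l = 1..n. of_real (char_coeffs n k l) * \<xi> l)"
proof -
  define p :: "complex poly" where "p = (\<Sum>l<n. monom (of_real (char_coeffs n k (Suc l))) l)"
  have coeff: "coeff p l = (if l < n then of_real (char_coeffs n k (Suc l)) else 0)" for l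
    by (simp add: p_def coeff_sum)
  have "coeff p (n - 1) = 1"
    using n by (simp add: coeff char_coeffs_def)
  moreover have "degree p \<le> n - 1"
    by (rule degree_le) (use n in \<open>auto simp: coeff\<close>)
  ultimately have deg: "degree p = n - 1"
    by (metis le_antisym le_degree zero_neq_one)
  then have lc: "lead_coeff p = 1"
    using \<open>coeff p (n - 1) = 1\<close> by simp
  then have "p \<noteq> 0"
    by auto
  obtain A where A: "size A = degree p" "p = smult (lead_coeff p) (\<Prod>x\<in>#A. [:- x, 1:])"
    using alg_closed_imp_factorization[OF \<open>p \<noteq> 0\<close>] by blast
  obtain xs where xs: "mset xs = A"
    using ex_mset by blast
  then have len: "length xs = n - 1"
    using A deg by (metis size_mset)
  have p: "p = (\<Prod>i<n - 1. [:- (xs ! i), 1:])"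
  proof -
    have "p = (\<Prod>x\<leftarrow>xs. [:- x, 1:])"
      using A lc by (simp flip: xs prod_mset_prod_list)
    also have "\<dots> = (\<Prod>i<n - 1. [:- (xs ! i), 1:])"
      by (simp add: prod.list_conv_set_nth len atLeast0LessThan)
    finally show ?thesis .
  qed
  have poly: "poly p s = s ^ (n - 1) + (\<Sum>l = 1..<n. of_real (k l) * s ^ (l - 1))" for s
  proof -
    have "poly p s = (\<Sum>l<n. of_real (char_coeffs n k (Suc l)) * s ^ l)"
      by (simp add: p_def poly_sum poly_monom)
    also have "\<dots> = (\<Sum>l = 1..<Suc n. of_real (char_coeffs n k l) * s ^ (l - 1))"
      by (rule sum.reindex_bij_witness[of _ "\<lambda>l. l - 1" Suc]) auto
    finally show ?thesis
      using n by (simp add: char_coeffs_def)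
  qed
  show thesis
  proof (rule that[of "\<lambda>j. xs ! j"])
    fix j assume "j < n - 1"
    then have "poly p (xs ! j) = 0"
      by (subst p) (auto simp: poly_prod)
    then show "Re (xs ! j) < 0"
      using hurwitz by (simp add: poly)
  next
    fix \<xi> :: "nat \<Rightarrow> complex"
    have "cascade (\<lambda>j. xs ! j) \<xi> (n - 1) 1 = (\<Sum>i\<le>n - 1. coeff p i * \<xi> (1 + i))"
      by (simp add: cascade_eq_sum p)
    also have "\<dots> = (\<Sum>l = 1..n. of_real (char_coeffs n k l) * \<xi> l)"
      using n by (intro sum.reindex_bij_witness[of _ "\<lambda>l. l - 1" Suc]) (auto simp: coeff)
    finally show "cascade (\<lambda>j. xs ! j) \<xi> (n - 1) 1 = \<dots>" .
  qed
qed

text \<open>The number is the value at 0 of a real monic polynomial. If it were not positive, the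
  intermediate value theorem would give a root in the closed right half plane.\<close>

lemma hurwitz_const_pos:
  assumes n: "n \<ge> 1"
    and hurwitz: "\<And>s::complex. s ^ (n - 1) + (\<Sum>l = 1..<n. of_real (k l) * s ^ (l - 1)) = 0 \<Longrightarrow> Re s < 0"
  shows "0 < char_coeffs n k 1"
proof (rule ccontr)
  assume neg: "\<not> 0 < char_coeffs n k 1"
  define p where "p = (\<Sum>l<n. monom (char_coeffs n k (Suc l)) l)"
  have coeff: "coeff p l = (if l < n then char_coeffs n k (Suc l) else 0)" for l
    by (simp add: p_def coeff_sum)
  have c1: "coeff p (n - 1) = 1"
    using n by (simp add: coeff char_coeffs_def)
  moreover have "degree p \<le> n - 1"
    by (rule degree_le) (use n in \<open>auto simp: coeff\<close>)
  ultimately have deg: "degree p = n - 1"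
    by (metis le_antisym le_degree zero_neq_one)
  obtain u where "\<forall>x\<ge>u. poly p x \<ge> lead_coeff p"
    using poly_pinfty_gt_lc[of p] deg c1 by auto
  then have pos: "0 < poly p (max u 1)"
    using deg c1 by (metis less_le_trans max.cobounded1 zero_less_one)
  have "poly p 0 \<le> 0"
    using neg n by (simp add: poly_0_coeff_0 coeff)
  then consider "poly p 0 = 0" | "poly p 0 < 0"
    by linarith
  then obtain s where s: "s \<ge> 0" "poly p s = 0"
  proof cases
    case 1
    then show ?thesis
      using that by blast
  next
    case 2
    have "0 < max u 1"
      by simp
    from poly_IVT_pos[OF this 2 pos] show ?thesis
      using that less_imp_le by blast
  qed
  have "poly p s = (\<Sum>l<n. char_coeffs n k (Suc l) * s ^ l)"
    by (simp add: p_def poly_sum poly_monom)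
  also have "\<dots> = (\<Sum>l = 1..<Suc n. char_coeffs n k l * s ^ (l - 1))"
    by (rule sum.reindex_bij_witness[of _ "\<lambda>l. l - 1" Suc]) auto
  also have "\<dots> = s ^ (n - 1) + (\<Sum>l = 1..<n. k l * s ^ (l - 1))"
    using n by (simp add: char_coeffs_def)
  finally have "of_real (s ^ (n - 1) + (\<Sum>l = 1..<n. k l * s ^ (l - 1))) = (0 :: complex)"
    using s by simp
  then show False
    using hurwitz[of "of_real s"] s by simp
qed


subsection \<open>Dissipation of the individual modes\<close>

lemma norm_le_sum_norm_nth: "norm (x :: 'a::real_normed_vector ^ 'n) \<le> (\<Sum>i\<in>UNIV. norm (x $ i))"
  unfolding norm_vec_def by (rule L2_set_le_sum) simp

lemma has_vector_derivative_vec: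
  fixes g :: "real \<Rightarrow> 'a::euclidean_space ^ 'n::finite"
  assumes "\<And>i. ((\<lambda>s. g s $ i) has_vector_derivative g' $ i) (at t within S)"
  shows "(g has_vector_derivative g') (at t within S)"
proof -
  have expand: "(\<Sum>i\<in>UNIV. axis i (v $ i)) = v" for v :: "'a ^ 'n"
    by (simp add: vec_eq_iff axis_def)
  have "((\<lambda>s. \<Sum>i\<in>UNIV. axis i (g s $ i)) has_vector_derivative (\<Sum>i\<in>UNIV. axis i (g' $ i)))
      (at t within S)"
    by (intro has_vector_derivative_sum bounded_linear.has_vector_derivative[OF bounded_linear_axis] assms)
  then show ?thesis
    by (simp add: expand)
qed

lemma has_real_derivative_norm_square:
  fixes z :: "real \<Rightarrow> 'a::real_inner"
  assumes "(z has_vector_derivative z') (at t within S)"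
  shows "((\<lambda>t. (norm (z t))\<^sup>2) has_real_derivative 2 * (z t \<bullet> z')) (at t within S)"
proof -
  have "((\<lambda>t. z t \<bullet> z t) has_derivative (\<lambda>h. z t \<bullet> (h *\<^sub>R z') + (h *\<^sub>R z') \<bullet> z t)) (at t within S)"
    using assms by (intro has_derivative_inner) (auto simp: has_vector_derivative_def)
  moreover have "(\<lambda>h. z t \<bullet> (h *\<^sub>R z') + (h *\<^sub>R z') \<bullet> z t) = (*) (2 * (z t \<bullet> z'))"
    by (auto simp: inner_commute)
  ultimately show ?thesis
    by (simp add: has_field_derivative_def power2_norm_eq_inner)
qed

text \<open>When node \<open>i\<close> attains its weighted bound, Cauchy-Schwarz bounds each
  coupling term from below by the same term with the errors replaced by their weights. The margin
  \<open>m\<close> of the weights then competes with the disturbance level \<open>u\<close>.\<close>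

lemma estimate_dissipation:
  fixes e :: "'p::finite \<Rightarrow> 'a::real_inner"
  assumes a: "\<And>q. 0 \<le> a $ q" "0 \<le> c"
    and le: "\<And>q. norm (e q) \<le> h * d q" and eq: "norm (e i) = h * d i" and v: "norm v \<le> h * u"
    and m: "m \<le> (\<Sum>q\<in>UNIV. a $ q * (d i - d q)) + c * d i" and h: "0 \<le> h"
  shows "e i \<bullet> (- ((\<Sum>q\<in>UNIV. a $ q *\<^sub>R (e i - e q)) + c *\<^sub>R e i) - v) \<le> - (h\<^sup>2 * d i * (m - u))"
proof -
  have hd: "0 \<le> h * d i"
    using eq by (metis norm_ge_zero)
  have term_ge: "a $ q * (h * d i * (h * (d i - d q))) \<le> e i \<bullet> (a $ q *\<^sub>R (e i - e q))" for q
  proof -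
    have "e i \<bullet> e q \<le> h * d i * (h * d q)"
      using norm_cauchy_schwarz[of "e i" "e q"] mult_left_mono[OF le[of q] hd] by (simp add: eq)
    moreover have "e i \<bullet> e i = h * d i * (h * d i)"
      by (simp add: eq power2_eq_square flip: power2_norm_eq_inner)
    ultimately have "h * d i * (h * (d i - d q)) \<le> e i \<bullet> (e i - e q)"
      by (simp add: inner_diff_right algebra_simps)
    then show ?thesis
      using a(1)[of q] by (simp add: mult_left_mono)
  qed
  have "- (e i \<bullet> v) \<le> h * d i * (h * u)"
    using norm_cauchy_schwarz[of "- e i" v] mult_left_mono[OF v hd] by (simp add: eq)
  moreover have "(\<Sum>q\<in>UNIV. a $ q * (h * d i * (h * (d i - d q)))) \<le> e i \<bullet> (\<Sum>q\<in>UNIV. a $ q *\<^sub>R (e i - e q))"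
    unfolding inner_sum_right by (intro sum_mono term_ge)
  moreover have "(\<Sum>q\<in>UNIV. a $ q * (h * d i * (h * (d i - d q))))
      = h * d i * h * (\<Sum>q\<in>UNIV. a $ q * (d i - d q))"
    by (simp add: sum_distrib_left mult_ac)
  moreover have "e i \<bullet> e i = h * d i * (h * d i)"
    by (simp add: eq power2_eq_square flip: power2_norm_eq_inner)
  moreover have "h * d i * h * m \<le> h * d i * h * ((\<Sum>q\<in>UNIV. a $ q * (d i - d q)) + c * d i)"
    using hd h by (intro mult_left_mono m) auto
  ultimately show ?thesis
    by (simp add: inner_diff_right inner_add_right power2_eq_square algebra_simps)
qed

text \<open>The factor \<open>\<rho>\<close> contributes \<open>Re \<rho>\<close> times the squared
  norm; the condition on \<open>c'\<close> lets the next mode consume half of this damping.\<close>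

lemma chain_dissipation:
  fixes z z' \<rho> :: complex
  assumes "norm z = h * c" "norm z' \<le> h * c'" "2 * c' = - Re \<rho> * c" "0 \<le> h * c"
  shows "z \<bullet> (z' + \<rho> * z) \<le> - (h\<^sup>2 * c * c')"
proof -
  have "z \<bullet> (\<rho> * z) = Re \<rho> * (norm z)\<^sup>2"
    by (simp add: inner_complex_def cmod_power2) (simp add: power2_eq_square algebra_simps)
  also have "\<dots> = - (2 * h\<^sup>2 * c * c')"
  proof -
    have "Re \<rho> * c = - (2 * c')"
      using assms(3) by simp
    moreover have "Re \<rho> * (h * c)\<^sup>2 = Re \<rho> * c * (h\<^sup>2 * c)"
      by (simp add: power2_eq_square)
    ultimately have "Re \<rho> * (h * c)\<^sup>2 = - (2 * c') * (h\<^sup>2 * c)"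
      by simp
    then show ?thesis
      by (simp add: assms(1))
  qed
  finally have "z \<bullet> (\<rho> * z) = - (2 * h\<^sup>2 * c * c')" .
  moreover have "z \<bullet> z' \<le> h * c * (h * c')"
    using norm_cauchy_schwarz[of z z'] mult_left_mono[OF assms(2,4)] by (simp add: assms(1))
  ultimately show ?thesis
    by (simp add: inner_add_right power2_eq_square algebra_simps)
qed

text \<open>These are weights as in \<open>chain_dissipation\<close>. Index \<open>d\<close> is
  included because its weight limits the input at the end of the chain.\<close>

lemma chain_weights:
  fixes \<rho> :: "nat \<Rightarrow> complex"
  assumes "\<And>j. j < d \<Longrightarrow> Re (\<rho> j) < 0"
  obtains c where "\<And>j. j \<le> d \<Longrightarrow> 0 < c j" "\<And>j. 2 * c (Suc j) = - Re (\<rho> j) * c j"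
proof -
  define c where "c j = (\<Prod>i<j. - Re (\<rho> i) / 2)" for j
  show thesis
  proof (rule that[of c])
    show "0 < c j" if "j \<le> d" for j
      unfolding c_def using assms that by (intro prod_pos) (auto simp: less_le_trans)
    show "2 * c (Suc j) = - Re (\<rho> j) * c j" for j
      by (simp add: c_def)
  qed
qed

text \<open>Recovers the scaled derivatives, coordinate by coordinate, from the chain amplitudes,
  linearly in the level \<open>h\<close>.\<close>

lemma chain_state_bound:
  fixes c :: "nat \<Rightarrow> real"
  assumes c: "\<And>j. j < n - 1 \<Longrightarrow> 0 < c j"
  obtains B where "0 \<le> B"
    "\<And>(\<xi> :: nat \<Rightarrow> ('m::finite, 'p::finite) profile) h. 0 \<le> h \<Longrightarrow>
      (\<And>j i q. j < n - 1 \<Longrightarrow> norm (cascade \<rho> (\<lambda>l. of_real (\<xi> l $ i $ q)) j 1) \<le> h * c j) \<Longrightarrow>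
      (\<Sum>l = 1..<n. norm (\<xi> l)) \<le> h * B"
proof -
  have "\<forall>l. \<exists>B\<ge>0. \<forall>\<xi>. norm (\<xi> (Suc l)) \<le> B * (\<Sum>i\<le>l. norm (cascade \<rho> \<xi> i 1))"
    using cascade_bound[of \<rho> 0] by simp
  then obtain B where B: "\<And>l. 0 \<le> B l"
    "\<And>l \<xi>. norm (\<xi> (Suc l)) \<le> B l * (\<Sum>i\<le>l. norm (cascade \<rho> \<xi> i 1))"
    by metis
  \<comment> \<open>The shift by one occurs because \<open>B l\<close> bounds entry
    \<open>Suc l\<close>.\<close>
  define b where "b l = B (l - 1) * (\<Sum>i\<le>l - 1. c i)" for l
  define A where "A = (\<Sum>l = 1..<n. \<Sum>i\<in>(UNIV::'p set). \<Sum>q\<in>(UNIV::'m set). b l)"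
  show thesis
  proof (rule that)
    have "0 \<le> b l" if "l \<in> {1..<n}" for l
      unfolding b_def using that c B(1) by (intro mult_nonneg_nonneg sum_nonneg less_imp_le[OF c]) auto
    then show "0 \<le> A"
      unfolding A_def by (intro sum_nonneg) auto
    fix \<xi> :: "nat \<Rightarrow> ('m, 'p) profile" and h :: real
    assume h: "0 \<le> h"
      and le: "\<And>j i q. j < n - 1 \<Longrightarrow> norm (cascade \<rho> (\<lambda>l. of_real (\<xi> l $ i $ q)) j 1) \<le> h * c j"
    have "norm (\<xi> l $ i $ q) \<le> h * b l" if l: "l \<in> {1..<n}" for l i q
    proof -
      have "norm (\<xi> l $ i $ q) = norm (complex_of_real (\<xi> (Suc (l - 1)) $ i $ q))"
        using l by simp
      also have "\<dots> \<le> B (l - 1) * (\<Sum>j\<le>l - 1. norm (cascade \<rho> (\<lambda>l. of_real (\<xi> l $ i $ q)) j 1))"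
        by (rule B(2))
      also have "\<dots> \<le> B (l - 1) * (\<Sum>j\<le>l - 1. h * c j)"
        using l by (intro mult_left_mono sum_mono le B(1)) auto
      finally show ?thesis
        by (simp add: b_def sum_distrib_left mult_ac)
    qed
    moreover have "norm (\<xi> l) \<le> (\<Sum>i\<in>UNIV. \<Sum>q\<in>UNIV. norm (\<xi> l $ i $ q))" for l
      by (rule order_trans[OF norm_le_sum_norm_nth]) (intro sum_mono norm_le_sum_norm_nth)
    ultimately have "norm (\<xi> l) \<le> (\<Sum>i\<in>(UNIV::'p set). \<Sum>q\<in>(UNIV::'m set). h * b l)"
      if "l \<in> {1..<n}" for l
      using that by (meson order_trans sum_mono)
    then have "(\<Sum>l = 1..<n. norm (\<xi> l)) \<le> (\<Sum>l = 1..<n. \<Sum>i\<in>(UNIV::'p set). \<Sum>q\<in>(UNIV::'m set). h * b l)"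
      by (rule sum_mono)
    then show "(\<Sum>l = 1..<n. norm (\<xi> l)) \<le> h * A"
      by (simp add: A_def sum_distrib_left mult_ac)
  qed
qed


subsection \<open>The closed loop\<close>

text \<open>The number of players is a parameter \<open>N\<close> of the locale because constants defined through
  \<open>CARD('p)\<close> would otherwise depend on an additional type argument.\<close>

locale nash_seeking =
  fixes a :: "real ^ 'p::finite ^ 'p"
    and J :: "'p \<Rightarrow> ('m::finite, 'p) profile \<Rightarrow> real"
    and n :: nat
    and f :: "'p \<Rightarrow> (real ^ 'm) list \<Rightarrow> real list \<Rightarrow> real ^ 'm"
    and w :: "'p \<Rightarrow> real list"
    and l\<^sub>x :: real and l\<^sub>d :: "nat \<Rightarrow> real"
    and \<omega> \<theta> :: real
    and k :: "nat \<Rightarrow> real"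
    and x_star :: "('m, 'p) profile"
    and N :: nat
  assumes n: "n \<ge> 1"
    and digraph: "weighted_digraph a"
    and connected: "strongly_connected a"
    and l\<^sub>x: "l\<^sub>x \<ge> 0" and l\<^sub>d: "\<And>l. l \<in> {1..<n} \<Longrightarrow> l\<^sub>d l \<ge> 0"
    and f_lipschitz: "\<And>i xs zs. length xs = n \<Longrightarrow> length zs = n \<Longrightarrow>
           norm (f i xs (w i) - f i zs (w i))
             \<le> l\<^sub>x * norm (xs ! 0 - zs ! 0) + (\<Sum>l = 1..<n. l\<^sub>d l * norm (xs ! l - zs ! l))"
    and \<omega>: "\<omega> > 0" and monotone: "strongly_monotone \<omega> (pseudo_gradient J)"
    and \<theta>: "\<theta> > 0" and lipschitz: "\<theta>-lipschitz_on UNIV (pseudo_gradient J)"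
    and hurwitz: "\<And>s::complex. s ^ (n - 1) + (\<Sum>l = 1..<n. of_real (k l) * s ^ (l - 1)) = 0 \<Longrightarrow> Re s < 0"
    and equilibrium: "pseudo_gradient J x_star = 0"
    and N: "N = CARD('p)"
begin

abbreviation K :: "nat \<Rightarrow> real" where
  "K \<equiv> char_coeffs n k"

definition K_sum :: real where
  "K_sum = (\<Sum>l<n. \<bar>K (Suc l)\<bar>) / K 1"

text \<open>The factor \<open>N\<close> comes from bounding the norm of a profile by the sum over
  the players.\<close>

definition L_fast :: real where
  "L_fast = real N * (\<Sum>l = 1..<n. l\<^sub>d l)"

definition L_slow :: real where
  "L_slow = real N * l\<^sub>x"

text \<open>The coefficient of \<open>norm p\<close> in the bound on the drift together with
  \<open>\<xi> (n - 1)\<close>; the added 1 accounts for the latter, which is \<open>\<xi> 0\<close>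
  if \<open>n = 1\<close>.\<close>

definition \<beta> :: real where
  "\<beta> = (L_slow + 1) / K 1"

text \<open>The weight of \<open>s\<close>, chosen so that the self-damping of \<open>s\<close>
  exceeds the coupling from \<open>p\<close> by 1.\<close>

definition \<sigma> :: real where
  "\<sigma> = \<beta> + 1"

text \<open>This value of \<alpha>1 gives
  \<open>gain * \<omega> / K 1 = \<beta> + \<sigma> + 1\<close>: it beats the self-coupling \<beta>
  of \<open>p\<close> and the coupling \<sigma> from \<open>s\<close> with margin 1.\<close>

definition gain :: real where
  "gain = (\<beta> + \<sigma> + 1) * K 1 / \<omega>"

text \<open>Collects every coefficient with which the scaled derivatives enter the slow
  equations.\<close>

definition C_fast :: real where
  "C_fast = (L_slow + 1) * K_sum + L_fast + 1 + gain * \<theta> * K_sum"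

lemma K1_pos: "0 < K 1"
  by (rule hurwitz_const_pos[OF n hurwitz])

lemma constants_nonneg: "0 \<le> K_sum" "0 \<le> L_fast" "0 \<le> L_slow" "0 < \<beta>" "1 < \<sigma>" "0 < gain" "0 < C_fast"
proof -
  show Ks: "0 \<le> K_sum"
    using K1_pos by (simp add: K_sum_def sum_nonneg)
  show Lf: "0 \<le> L_fast"
    unfolding L_fast_def using l\<^sub>d by (intro mult_nonneg_nonneg sum_nonneg) auto
  show Ls: "0 \<le> L_slow"
    using l\<^sub>x by (simp add: L_slow_def)
  show b: "0 < \<beta>"
    using Ls K1_pos by (simp add: \<beta>_def)
  then show s: "1 < \<sigma>"
    by (simp add: \<sigma>_def)
  show g: "0 < gain"
    using b s K1_pos \<omega> by (simp add: gain_def)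
  have "0 \<le> (L_slow + 1) * K_sum" "0 \<le> gain * \<theta> * K_sum"
    using Ks Ls g \<theta> by simp_all
  then show "0 < C_fast"
    using Lf by (simp add: C_fast_def)
qed

text \<open>The variable \<open>p\<close> plays the role of \<open>x - x_star\<close> up to the factor \<open>K 1\<close> and an error that
  involves derivatives only; unlike \<open>x - x_star\<close> its derivative contains the gradient directly.\<close>

lemma slow_estimates:
  fixes \<xi> :: "nat \<Rightarrow> ('m, 'p) profile" and p s \<Delta> G :: "('m, 'p) profile" and E \<Phi> \<Psi> :: real
  defines "\<Phi> \<equiv> \<Sum>l = 1..<n. norm (\<xi> l)"
  defines "p \<equiv> \<Sum>l<n. K (Suc l) *\<^sub>R \<xi> l"
  defines "\<eta> \<equiv> s - \<xi> (n - 1)"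
  assumes E: "1 \<le> E"
    and \<Delta>: "norm \<Delta> \<le> L_slow * norm (\<xi> 0) + E * L_fast * \<Phi>"
    and G: "norm (G - pseudo_gradient J (x_star + \<xi> 0)) \<le> \<theta> * \<Psi>"
  shows "norm (\<xi> 0) \<le> norm p / K 1 + K_sum * \<Phi>"
    and "p \<bullet> (\<Delta> - gain *\<^sub>R G - \<eta>)
      \<le> norm p * ((\<beta> - gain * \<omega> / K 1) * norm p + norm s + E * C_fast * \<Phi> + gain * \<theta> * \<Psi>)"
    and "s \<bullet> (\<Delta> - \<eta>) \<le> norm s * (\<beta> * norm p - norm s + E * C_fast * \<Phi>)"
    and "norm (\<Delta> - gain *\<^sub>R G - \<eta>)
      \<le> (\<beta> + gain * \<theta> / K 1) * norm p + norm s + E * C_fast * \<Phi> + gain * \<theta> * \<Psi>"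
proof -
  let ?F = "pseudo_gradient J"
  note pos = constants_nonneg K1_pos \<omega> \<theta>
  have \<Phi>0: "0 \<le> \<Phi>"
    by (simp add: \<Phi>_def sum_nonneg)
  have \<Psi>0: "0 \<le> \<theta> * \<Psi>"
    using G norm_ge_zero order_trans by blast
  have split: "(\<Sum>l<n. g l) = g 0 + (\<Sum>l = 1..<n. g l)" for g :: "nat \<Rightarrow> 'b::comm_monoid_add"
    using n by (simp add: lessThan_atLeast0 sum.atLeast_Suc_lessThan)
  define r where "r = (\<Sum>l = 1..<n. K (Suc l) *\<^sub>R \<xi> l)"
  have p: "p = K 1 *\<^sub>R \<xi> 0 + r"
    by (simp add: p_def r_def split)
  have r: "norm r / K 1 \<le> K_sum * \<Phi>"
  proof -
    have "norm r \<le> (\<Sum>l = 1..<n. \<bar>K (Suc l)\<bar> * norm (\<xi> l))"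
      unfolding r_def by (rule sum_norm_le) simp
    also have "\<dots> \<le> (\<Sum>l = 1..<n. (\<Sum>l<n. \<bar>K (Suc l)\<bar>) * norm (\<xi> l))"
      by (intro sum_mono mult_right_mono member_le_sum) auto
    also have "\<dots> = (\<Sum>l<n. \<bar>K (Suc l)\<bar>) * \<Phi>"
      by (simp add: \<Phi>_def sum_distrib_left)
    finally show ?thesis
      using K1_pos by (simp add: K_sum_def divide_right_mono)
  qed
  have \<xi>0: "\<xi> 0 = (1 / K 1) *\<^sub>R p - (1 / K 1) *\<^sub>R r"
    using K1_pos by (simp add: p algebra_simps)
  have "norm (\<xi> 0) \<le> norm ((1 / K 1) *\<^sub>R p) + norm ((1 / K 1) *\<^sub>R r)"
    unfolding \<xi>0 by (rule norm_triangle_ineq4)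
  then have "norm (\<xi> 0) \<le> norm p / K 1 + norm r / K 1"
    using K1_pos by simp
  then show \<xi>0_le: "norm (\<xi> 0) \<le> norm p / K 1 + K_sum * \<Phi>"
    using r by linarith
  \<comment> \<open>For \<open>n = 1\<close> this entry is \<open>\<xi> 0\<close> itself, otherwise
    it is a summand of \<open>\<Phi>\<close>.\<close>
  have last: "norm (\<xi> (n - 1)) \<le> norm (\<xi> 0) + \<Phi>"
  proof (cases "n = 1")
    case False
    then have "norm (\<xi> (n - 1)) \<le> \<Phi>"
      unfolding \<Phi>_def using n by (intro member_le_sum) auto
    then show ?thesis
      by (simp add: add_increasing)
  qed (use \<Phi>0 in simp)
  have E\<Phi>: "c * \<Phi> \<le> E * c * \<Phi>" if "0 \<le> c" for c
    using mult_right_mono[OF E, of "c * \<Phi>"] that \<Phi>0 by (simp add: mult_ac)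
  have C_split: "E * C_fast * \<Phi>
      = E * ((L_slow + 1) * K_sum) * \<Phi> + E * L_fast * \<Phi> + E * 1 * \<Phi> + E * (gain * \<theta> * K_sum) * \<Phi>"
    by (simp add: C_fast_def algebra_simps)
  have gKs: "0 \<le> gain * \<theta> * K_sum" "0 \<le> (L_slow + 1) * K_sum"
    using pos by simp_all
  have \<Delta>\<xi>: "norm \<Delta> + norm (\<xi> (n - 1)) + gain * \<theta> * K_sum * \<Phi> \<le> \<beta> * norm p + E * C_fast * \<Phi>"
  proof -
    have "(L_slow + 1) * norm (\<xi> 0) \<le> (L_slow + 1) * (norm p / K 1 + K_sum * \<Phi>)"
      using pos by (intro mult_left_mono \<xi>0_le) auto
    also have "\<dots> = \<beta> * norm p + (L_slow + 1) * K_sum * \<Phi>"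
      by (simp add: \<beta>_def algebra_simps)
    finally show ?thesis
      using \<Delta> last E\<Phi>[OF gKs(1)] E\<Phi>[OF gKs(2)] E\<Phi>[of 1] unfolding C_split
      by (simp add: distrib_right)
  qed
  have g\<Phi>: "0 \<le> gain * \<theta> * K_sum * \<Phi>"
    using gKs \<Phi>0 by simp
  have \<eta>: "norm \<eta> \<le> norm s + norm (\<xi> (n - 1))"
    unfolding \<eta>_def by (rule norm_triangle_ineq4)
  have F_diff: "norm (?F x - ?F y) \<le> \<theta> * norm (x - y)" for x y
    using lipschitz_onD[OF lipschitz, of x y] by (simp add: dist_norm)
  \<comment> \<open>Strong monotonicity is used at this point instead of
    \<open>x_star + \<xi> 0\<close>, so that the inner product is with \<open>p\<close>; the two
    points differ by \<open>r / K 1\<close>, which involves derivatives only.\<close>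
  let ?y = "x_star + (1 / K 1) *\<^sub>R p"
  have Gp: "p \<bullet> G \<ge> \<omega> / K 1 * (norm p)\<^sup>2 - norm p * (\<theta> * K_sum * \<Phi> + \<theta> * \<Psi>)"
  proof -
    have "\<omega> * (norm ((1 / K 1) *\<^sub>R p))\<^sup>2 \<le> ((1 / K 1) *\<^sub>R p) \<bullet> ?F ?y"
      using monotone[unfolded strongly_monotone_def, rule_format, where x = ?y and y = x_star]
      by (simp add: equilibrium)
    then have "K 1 * (\<omega> * (norm p / K 1)\<^sup>2) \<le> K 1 * ((1 / K 1) * (p \<bullet> ?F ?y))"
      using K1_pos by (intro mult_left_mono) auto
    then have 1: "\<omega> / K 1 * (norm p)\<^sup>2 \<le> p \<bullet> ?F ?y"
      using K1_pos by (simp add: power2_eq_square)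
    have "norm (?F ?y - ?F (x_star + \<xi> 0)) \<le> \<theta> * norm (?y - (x_star + \<xi> 0))"
      by (rule F_diff)
    also have "?y - (x_star + \<xi> 0) = (1 / K 1) *\<^sub>R r"
      by (simp add: \<xi>0)
    also have "norm ((1 / K 1) *\<^sub>R r) = norm r / K 1"
      using K1_pos by simp
    also have "\<theta> * (norm r / K 1) \<le> \<theta> * (K_sum * \<Phi>)"
      using r \<theta> by (intro mult_left_mono) auto
    finally have 2: "norm (?F ?y - ?F (x_star + \<xi> 0)) \<le> \<theta> * K_sum * \<Phi>"
      by (simp add: mult_ac)
    have "norm (?F ?y - G) \<le> norm (?F ?y - ?F (x_star + \<xi> 0)) + norm (?F (x_star + \<xi> 0) - G)"
      using norm_triangle_ineq[of "?F ?y - ?F (x_star + \<xi> 0)" "?F (x_star + \<xi> 0) - G"] by simp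
    then have "norm (?F ?y - G) \<le> \<theta> * K_sum * \<Phi> + \<theta> * \<Psi>"
      using 2 G by (simp add: norm_minus_commute)
    then have "p \<bullet> (?F ?y - G) \<le> norm p * (\<theta> * K_sum * \<Phi> + \<theta> * \<Psi>)"
      using norm_cauchy_schwarz[of p "?F ?y - G"] by (meson mult_left_mono norm_ge_zero order_trans)
    then show ?thesis
      using 1 by (simp add: inner_diff_right)
  qed
  have "p \<bullet> (\<Delta> - gain *\<^sub>R G - \<eta>) \<le> norm p * norm \<Delta> + norm p * norm \<eta> - gain * (p \<bullet> G)"
    using norm_cauchy_schwarz[of p \<Delta>] norm_cauchy_schwarz[of p "- \<eta>"]
    by (simp add: inner_diff_right)
  also have "\<dots> \<le> norm p * norm \<Delta> + norm p * norm \<eta>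
      - gain * (\<omega> / K 1 * (norm p)\<^sup>2 - norm p * (\<theta> * K_sum * \<Phi> + \<theta> * \<Psi>))"
    using mult_left_mono[OF Gp, of gain] pos by simp
  also have "\<dots> = norm p * (norm \<Delta> + norm \<eta> + gain * \<theta> * K_sum * \<Phi> - gain * \<omega> / K 1 * norm p
      + gain * \<theta> * \<Psi>)"
    by (simp add: power2_eq_square algebra_simps)
  also have "\<dots> \<le> norm p * ((\<beta> - gain * \<omega> / K 1) * norm p + norm s + E * C_fast * \<Phi> + gain * \<theta> * \<Psi>)"
    using \<Delta>\<xi> \<eta> by (intro mult_left_mono) (auto simp: left_diff_distrib)
  finally show "p \<bullet> (\<Delta> - gain *\<^sub>R G - \<eta>)
      \<le> norm p * ((\<beta> - gain * \<omega> / K 1) * norm p + norm s + E * C_fast * \<Phi> + gain * \<theta> * \<Psi>)" .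
  have "s \<bullet> (\<Delta> - \<eta>) = s \<bullet> \<Delta> + s \<bullet> \<xi> (n - 1) - (norm s)\<^sup>2"
    by (simp add: \<eta>_def inner_diff_right power2_norm_eq_inner)
  also have "\<dots> \<le> norm s * norm \<Delta> + norm s * norm (\<xi> (n - 1)) - (norm s)\<^sup>2"
    by (intro diff_mono add_mono norm_cauchy_schwarz) simp
  also have "\<dots> = norm s * (norm \<Delta> + norm (\<xi> (n - 1)) - norm s)"
    by (simp add: power2_eq_square algebra_simps)
  also have "\<dots> \<le> norm s * (\<beta> * norm p - norm s + E * C_fast * \<Phi>)"
    using \<Delta>\<xi> g\<Phi> by (intro mult_left_mono) auto
  finally show "s \<bullet> (\<Delta> - \<eta>) \<le> norm s * (\<beta> * norm p - norm s + E * C_fast * \<Phi>)" .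
  have "norm G \<le> norm (G - ?F (x_star + \<xi> 0)) + norm (?F (x_star + \<xi> 0) - ?F x_star)"
    using norm_triangle_ineq[of "G - ?F (x_star + \<xi> 0)" "?F (x_star + \<xi> 0)"] by (simp add: equilibrium)
  also have "\<dots> \<le> \<theta> * \<Psi> + \<theta> * norm (\<xi> 0)"
    using G F_diff[of "x_star + \<xi> 0" x_star] by simp
  also have "\<dots> \<le> \<theta> * \<Psi> + \<theta> * (norm p / K 1 + K_sum * \<Phi>)"
    using \<theta> \<xi>0_le by simp
  finally have "gain * norm G \<le> gain * (\<theta> * \<Psi> + \<theta> * (norm p / K 1 + K_sum * \<Phi>))"
    using pos by (intro mult_left_mono) auto
  moreover have "norm (\<Delta> - gain *\<^sub>R G - \<eta>) \<le> norm \<Delta> + gain * norm G + norm \<eta>"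
    using norm_triangle_ineq4[of "\<Delta> - gain *\<^sub>R G" \<eta>] norm_triangle_ineq4[of \<Delta> "gain *\<^sub>R G"] pos
    by simp
  ultimately show "norm (\<Delta> - gain *\<^sub>R G - \<eta>)
      \<le> (\<beta> + gain * \<theta> / K 1) * norm p + norm s + E * C_fast * \<Phi> + gain * \<theta> * \<Psi>"
    using \<Delta>\<xi> \<eta> by (simp add: algebra_simps)
qed

text \<open>At level \<open>h\<close> the weights 1 and \<sigma> leave the margin \<open>h\<close>
  in both equations; the perturbation uses up half of it. The last bound limits the input to the
  fast modes.\<close>

lemma slow_dissipation:
  fixes h \<Phi> \<Psi> E :: real and p s :: "('m, 'p) profile"
  assumes p: "norm p \<le> h" and s: "norm s \<le> h * \<sigma>"
    and pert: "E * C_fast * \<Phi> + gain * \<theta> * \<Psi> \<le> h / 2" "0 \<le> \<Psi>"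
  shows "norm p = h \<Longrightarrow> (\<beta> - gain * \<omega> / K 1) * norm p + norm s + E * C_fast * \<Phi> + gain * \<theta> * \<Psi> \<le> - (h / 2)"
    and "norm s = h * \<sigma> \<Longrightarrow> \<beta> * norm p - norm s + E * C_fast * \<Phi> \<le> - (h / 2)"
    and "(\<beta> + gain * \<theta> / K 1) * norm p + norm s + E * C_fast * \<Phi> + gain * \<theta> * \<Psi>
      \<le> h * (\<beta> + gain * \<theta> / K 1 + \<sigma> + 1 / 2)"
proof -
  note pos = constants_nonneg K1_pos \<omega> \<theta>
  have "gain * \<omega> / K 1 = \<beta> + \<sigma> + 1"
    using pos by (simp add: gain_def)
  then show "(\<beta> - gain * \<omega> / K 1) * norm p + norm s + E * C_fast * \<Phi> + gain * \<theta> * \<Psi> \<le> - (h / 2)"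
    if "norm p = h"
    using that s pert by (simp add: algebra_simps)
  have "0 \<le> gain * \<theta> * \<Psi>"
    using pos pert(2) by simp
  then show "\<beta> * norm p - norm s + E * C_fast * \<Phi> \<le> - (h / 2)" if "norm s = h * \<sigma>"
  proof -
    have "\<beta> * norm p \<le> \<beta> * h"
      using pos by (intro mult_left_mono p) auto
    moreover have "norm s = h * \<beta> + h"
      using that by (simp add: \<sigma>_def algebra_simps)
    ultimately show ?thesis
      using pert(1) \<open>0 \<le> gain * \<theta> * \<Psi>\<close> by (simp only: mult.commute[of h \<beta>])
  qed
  have "(\<beta> + gain * \<theta> / K 1) * norm p \<le> (\<beta> + gain * \<theta> / K 1) * h"
    using pos by (intro mult_left_mono p) auto
  then show "(\<beta> + gain * \<theta> / K 1) * norm p + norm s + E * C_fast * \<Phi> + gain * \<theta> * \<Psi>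
      \<le> h * (\<beta> + gain * \<theta> / K 1 + \<sigma> + 1 / 2)"
    using s pert by (simp add: algebra_simps)
qed

end


section \<open>Scaled coordinates and their differential equations\<close>

context nash_seeking
begin

text \<open>At rest at \<open>x_star\<close> the gradient vanishes, so with \<alpha>2 equal to 1 the
  integral state has to cancel the nonlinearity.\<close>

definition y_star :: "('m, 'p) profile" where
  "y_star = (\<chi> i. f i (map (\<lambda>l. if l = 0 then x_star $ i else 0) [0..<n]) (w i))"

definition drift :: "(nat \<Rightarrow> real \<Rightarrow> ('m, 'p) profile) \<Rightarrow> real \<Rightarrow> ('m, 'p) profile" where
  "drift x t = (\<chi> i. f i (map (\<lambda>l. x l t $ i) [0..<n]) (w i)) - y_star"

definition estimated_pseudo_gradient ::
  "(nat \<Rightarrow> real \<Rightarrow> ('m, 'p) profile) \<Rightarrow> (real \<Rightarrow> ('m, 'p) profile ^ 'p) \<Rightarrow> real \<Rightarrow> ('m, 'p) profile" where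
  "estimated_pseudo_gradient x xh t = (\<chi> i. estimated_gradient J x xh i t)"

text \<open>The scaling turns differentiation into \<epsilon> times the index shift.\<close>

definition scaled :: "real \<Rightarrow> (nat \<Rightarrow> real \<Rightarrow> ('m, 'p) profile) \<Rightarrow> real \<Rightarrow> nat \<Rightarrow> ('m, 'p) profile" where
  "scaled \<epsilon> x t l = (if l = 0 then x 0 t - x_star else (1 / \<epsilon> ^ l) *\<^sub>R x l t)"

end

text \<open>A solution for \<alpha>1 equal to \<open>gain\<close>, \<alpha>2 equal to 1 and
  \<alpha>3 equal to \<epsilon>. Here \<open>'a\<close> indexes players and \<open>'b\<close>
  coordinates.\<close>

locale nash_seeking_solution = nash_seeking +
  fixes \<epsilon> :: real and x :: "nat \<Rightarrow> real \<Rightarrow> ('b, 'a) profile" and y :: "real \<Rightarrow> ('b, 'a) profile"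
    and xh :: "real \<Rightarrow> ('b, 'a) profile ^ 'a"
  assumes \<epsilon>: "\<epsilon> \<ge> 1"
    and solution: "closed_loop_solution n a J f w k gain 1 \<epsilon> \<epsilon> x y xh"
begin

abbreviation \<xi> :: "real \<Rightarrow> nat \<Rightarrow> ('b, 'a) profile" where
  "\<xi> \<equiv> scaled \<epsilon> x"

abbreviation \<Delta> :: "real \<Rightarrow> ('b, 'a) profile" where
  "\<Delta> \<equiv> drift x"

abbreviation G :: "real \<Rightarrow> ('b, 'a) profile" where
  "G \<equiv> estimated_pseudo_gradient x xh"

definition p :: "real \<Rightarrow> ('b, 'a) profile" where
  "p t = (\<Sum>l<n. K (Suc l) *\<^sub>R \<xi> t l)"

definition s :: "real \<Rightarrow> ('b, 'a) profile" where
  "s t = \<xi> t (n - 1) + (y t - y_star)"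

definition \<Phi> :: "real \<Rightarrow> real" where
  "\<Phi> t = (\<Sum>l = 1..<n. norm (\<xi> t l))"

text \<open>With a single player the estimates do not converge, but they are not used either.\<close>

definition \<Psi> :: "real \<Rightarrow> real" where
  "\<Psi> t = (\<Sum>i\<in>UNIV. \<Sum>j\<in>UNIV. if \<exists>u v :: 'a. u \<noteq> v then norm (xh t $ i $ j - x 0 t $ j) else 0)"

text \<open>The common input of the slow variable \<open>p\<close> and of the end of the chain; the
  last bracket is \<open>y t - y_star\<close>.\<close>

definition forcing :: "real \<Rightarrow> ('b, 'a) profile" where
  "forcing t = \<Delta> t - gain *\<^sub>R G t - (s t - \<xi> t (n - 1))"

text \<open>The chain starts at the first derivative, because the decision error itself is handled
  through \<open>p\<close>; complex values accommodate complex roots.\<close>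

definition \<zeta> :: "(nat \<Rightarrow> complex) \<Rightarrow> nat \<Rightarrow> 'a \<Rightarrow> 'b \<Rightarrow> real \<Rightarrow> complex" where
  "\<zeta> \<rho> j i q t = cascade \<rho> (\<lambda>l. of_real (\<xi> t l $ i $ q)) j 1"

lemma \<epsilon>_pos: "\<epsilon> > 0"
  using \<epsilon> by simp

lemma
  assumes "t \<ge> 0"
  shows sol_x: "l < n \<Longrightarrow> ((\<lambda>s. x l s $ i) has_vector_derivative x (Suc l) t $ i) (at t within {0..})"
    and sol_xn: "x n t $ i = f i (map (\<lambda>l. x l t $ i) [0..<n]) (w i)
        + state_control n J k gain 1 \<epsilon> x y xh i t"
    and sol_y: "((\<lambda>s. y s $ i) has_vector_derivative
           (\<Sum>l = 1..<n. (\<epsilon> powi (1 - int l) * k l) *\<^sub>R x l t $ i)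
           + (gain / \<epsilon> ^ (n - 1)) *\<^sub>R estimated_gradient J x xh i t) (at t within {0..})"
    and sol_xh: "((\<lambda>s. xh s $ i $ j) has_vector_derivative
           - \<epsilon> *\<^sub>R ((\<Sum>q\<in>UNIV. a $ i $ q *\<^sub>R (xh t $ i $ j - xh t $ q $ j))
                    + a $ i $ j *\<^sub>R (xh t $ i $ j - x 0 t $ j))) (at t within {0..})"
  using solution assms unfolding closed_loop_solution_def by blast+

lemma \<xi>_deriv:
  assumes "t \<ge> 0" "l < n"
  shows "((\<lambda>t. \<xi> t l) has_vector_derivative \<epsilon> *\<^sub>R \<xi> t (Suc l)) (at t within {0..})"
proof -
  have x: "(x l has_vector_derivative x (Suc l) t) (at t within {0..})"
    using sol_x[OF assms] by (rule has_vector_derivative_vec)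
  have *: "\<epsilon> *\<^sub>R \<xi> t (Suc l) = (1 / \<epsilon> ^ l) *\<^sub>R x (Suc l) t"
    using \<epsilon>_pos by (simp add: scaled_def)
  show ?thesis
  proof (cases "l = 0")
    case True
    then show ?thesis
      using has_vector_derivative_diff[OF x has_vector_derivative_const, of x_star] *
      by (simp add: scaled_def)
  next
    case False
    then show ?thesis
      using bounded_linear.has_vector_derivative[OF bounded_linear_scaleR_right x, of "1 / \<epsilon> ^ l"]
      unfolding * by (simp add: scaled_def)
  qed
qed

text \<open>The sum on the left cancels the derivative feedback of the control, and
  \<open>y_star\<close> cancels between the drift and \<open>s\<close>.\<close>

lemma forcing_eq:
  assumes "t \<ge> 0"
  shows "\<xi> t n + (\<Sum>l = 1..<n. k l *\<^sub>R \<xi> t l) = (1 / \<epsilon> ^ n) *\<^sub>R forcing t"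
proof -
  have "x n t + (\<Sum>l = 1..<n. (\<epsilon> ^ (n - l) * k l) *\<^sub>R x l t) = forcing t"
  proof (subst vec_eq_iff, intro allI)
    fix i
    have "forcing t $ i = f i (map (\<lambda>l. x l t $ i) [0..<n]) (w i)
        - gain *\<^sub>R estimated_gradient J x xh i t - y t $ i"
      by (simp add: forcing_def drift_def s_def estimated_pseudo_gradient_def)
    then show "(x n t + (\<Sum>l = 1..<n. (\<epsilon> ^ (n - l) * k l) *\<^sub>R x l t)) $ i = forcing t $ i"
      unfolding vector_add_component sol_xn[OF assms] state_control_def sum_component
        vector_scaleR_component by simp
  qed
  then have "(1 / \<epsilon> ^ n) *\<^sub>R forcing t
      = (1 / \<epsilon> ^ n) *\<^sub>R (x n t + (\<Sum>l = 1..<n. (\<epsilon> ^ (n - l) * k l) *\<^sub>R x l t))"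
    by (rule arg_cong[OF sym])
  also have "\<dots> = (1 / \<epsilon> ^ n) *\<^sub>R x n t
      + (\<Sum>l = 1..<n. (1 / \<epsilon> ^ n) *\<^sub>R (\<epsilon> ^ (n - l) * k l) *\<^sub>R x l t)"
    by (simp only: scaleR_right_distrib scaleR_sum_right)
  also have "(\<Sum>l = 1..<n. (1 / \<epsilon> ^ n) *\<^sub>R (\<epsilon> ^ (n - l) * k l) *\<^sub>R x l t) = (\<Sum>l = 1..<n. k l *\<^sub>R \<xi> t l)"
    using \<epsilon>_pos by (intro sum.cong) (auto simp: scaled_def power_diff)
  finally show ?thesis
    using n by (simp add: scaled_def)
qed

lemma y_deriv:
  assumes "t \<ge> 0"
  shows "(y has_vector_derivative \<epsilon> *\<^sub>R (\<Sum>l = 1..<n. k l *\<^sub>R \<xi> t l) + (gain / \<epsilon> ^ (n - 1)) *\<^sub>R G t)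
    (at t within {0..})"
proof (rule has_vector_derivative_vec)
  fix i
  have "(\<Sum>l = 1..<n. (\<epsilon> powi (1 - int l) * k l) *\<^sub>R x l t $ i)
      = (\<Sum>l = 1..<n. \<epsilon> *\<^sub>R k l *\<^sub>R \<xi> t l $ i)"
    using \<epsilon>_pos by (intro sum.cong) (auto simp: scaled_def power_int_diff)
  then show "((\<lambda>s. y s $ i) has_vector_derivative
      (\<epsilon> *\<^sub>R (\<Sum>l = 1..<n. k l *\<^sub>R \<xi> t l) + (gain / \<epsilon> ^ (n - 1)) *\<^sub>R G t) $ i) (at t within {0..})"
    using sol_y[OF assms, of i] by (simp add: estimated_pseudo_gradient_def scaleR_sum_right)
qed

lemma p_deriv:
  assumes "t \<ge> 0"
  shows "(p has_vector_derivative (1 / \<epsilon> ^ (n - 1)) *\<^sub>R forcing t) (at t within {0..})"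
proof -
  have "(p has_vector_derivative (\<Sum>l<n. K (Suc l) *\<^sub>R \<epsilon> *\<^sub>R \<xi> t (Suc l))) (at t within {0..})"
    unfolding p_def[abs_def]
    by (intro has_vector_derivative_sum bounded_linear.has_vector_derivative[OF bounded_linear_scaleR_right]
          \<xi>_deriv assms) simp
  also have "(\<Sum>l<n. K (Suc l) *\<^sub>R \<epsilon> *\<^sub>R \<xi> t (Suc l)) = (\<Sum>l = 1..<Suc n. K l *\<^sub>R \<epsilon> *\<^sub>R \<xi> t l)"
    by (rule sum.reindex_bij_witness[of _ "\<lambda>l. l - 1" Suc]) auto
  also have "\<dots> = \<epsilon> *\<^sub>R (\<xi> t n + (\<Sum>l = 1..<n. k l *\<^sub>R \<xi> t l))"
    using n by (simp add: char_coeffs_def scaleR_sum_right scaleR_right_distrib mult.commute)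
  also have "\<dots> = (1 / \<epsilon> ^ (n - 1)) *\<^sub>R forcing t"
    unfolding forcing_eq[OF assms] using \<epsilon>_pos n by (simp add: power_diff)
  finally show ?thesis .
qed

text \<open>Adding the integral state to the last scaled derivative cancels the derivative feedback
  and the gradient, which leaves self-damping and drift.\<close>

lemma s_deriv:
  assumes "t \<ge> 0"
  shows "(s has_vector_derivative (1 / \<epsilon> ^ (n - 1)) *\<^sub>R (\<Delta> t - (s t - \<xi> t (n - 1)))) (at t within {0..})"
proof -
  have "((\<lambda>t. \<xi> t (n - 1)) has_vector_derivative \<epsilon> *\<^sub>R \<xi> t n) (at t within {0..})"
    using \<xi>_deriv[OF assms, of "n - 1"] n by simp
  then have "(s has_vector_derivative \<epsilon> *\<^sub>R \<xi> t n
      + (\<epsilon> *\<^sub>R (\<Sum>l = 1..<n. k l *\<^sub>R \<xi> t l) + (gain / \<epsilon> ^ (n - 1)) *\<^sub>R G t - 0)) (at t within {0..})"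
    unfolding s_def[abs_def]
    by (intro has_vector_derivative_add has_vector_derivative_diff y_deriv has_vector_derivative_const assms)
  also have "\<epsilon> *\<^sub>R \<xi> t n + (\<epsilon> *\<^sub>R (\<Sum>l = 1..<n. k l *\<^sub>R \<xi> t l) + (gain / \<epsilon> ^ (n - 1)) *\<^sub>R G t - 0)
      = \<epsilon> *\<^sub>R (1 / \<epsilon> ^ n) *\<^sub>R forcing t + (gain / \<epsilon> ^ (n - 1)) *\<^sub>R G t"
    by (simp add: scaleR_right_distrib flip: forcing_eq[OF assms])
  also have "\<dots> = (1 / \<epsilon> ^ (n - 1)) *\<^sub>R forcing t + (1 / \<epsilon> ^ (n - 1)) *\<^sub>R gain *\<^sub>R G t"
    using \<epsilon>_pos n by (simp add: power_diff)
  also have "\<dots> = (1 / \<epsilon> ^ (n - 1)) *\<^sub>R (\<Delta> t - (s t - \<xi> t (n - 1)))"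
    unfolding scaleR_right_distrib[symmetric] by (simp add: forcing_def)
  finally show ?thesis .
qed

text \<open>Differences of estimates equal differences of errors, and the moving target contributes
  its velocity, which is \<epsilon> times \<open>\<xi> t 1\<close>.\<close>

lemma estimate_deriv:
  fixes j :: 'a
  assumes "t \<ge> 0"
  defines "e \<equiv> \<lambda>q t. xh t $ q $ j - x 0 t $ j"
  shows "(e i has_vector_derivative
    \<epsilon> *\<^sub>R (- ((\<Sum>q\<in>UNIV. a $ i $ q *\<^sub>R (e i t - e q t)) + a $ i $ j *\<^sub>R e i t) - \<xi> t 1 $ j)) (at t within {0..})"
proof -
  have "\<epsilon> *\<^sub>R \<xi> t 1 $ j = x (Suc 0) t $ j"
    using \<epsilon>_pos by (simp add: scaled_def)
  then show ?thesis
    unfolding e_def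
    using has_vector_derivative_diff[OF sol_xh[OF assms(1), of i j] sol_x[OF assms(1), of 0 j]] n
    by (simp add: algebra_simps)
qed

text \<open>For \<open>n = 1\<close> the velocity is no state and is not part of
  \<open>\<Phi>\<close>; it is then given by the forcing.\<close>

lemma \<xi>1_le:
  assumes "t \<ge> 0"
  shows "norm (\<xi> t 1) \<le> \<Phi> t + norm (forcing t) / \<epsilon> ^ n"
proof (cases "n = 1")
  case True
  then have "norm (\<xi> t 1) = norm (forcing t) / \<epsilon> ^ n"
    using forcing_eq[OF assms] \<epsilon>_pos by simp
  then show ?thesis
    by (simp add: \<Phi>_def sum_nonneg)
next
  case False
  then have "norm (\<xi> t 1) \<le> \<Phi> t"
    unfolding \<Phi>_def using n by (intro member_le_sum) auto
  moreover have "0 \<le> norm (forcing t) / \<epsilon> ^ n"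
    using \<epsilon>_pos by simp
  ultimately show ?thesis
    by linarith
qed

lemma \<zeta>_deriv:
  assumes "t \<ge> 0" "j < n - 1"
  shows "(\<zeta> \<rho> j i q has_vector_derivative \<epsilon> *\<^sub>R (\<zeta> \<rho> (Suc j) i q t + \<rho> j * \<zeta> \<rho> j i q t)) (at t within {0..})"
proof -
  have bl: "bounded_linear (\<lambda>v :: ('b, 'a) profile. complex_of_real (v $ i $ q))"
    by (intro bounded_linear_compose[OF bounded_linear_of_real] bounded_linear_compose[OF bounded_linear_vec_nth]
        bounded_linear_vec_nth)
  have "((\<lambda>t. complex_of_real (\<xi> t l $ i $ q)) has_vector_derivative
      \<epsilon> *\<^sub>R complex_of_real (\<xi> t (Suc l) $ i $ q)) (at t within {0..})" if "l < n" for l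
    using bounded_linear.has_vector_derivative[OF bl \<xi>_deriv[OF assms(1) that]]
    unfolding linear_cmul[OF bounded_linear.linear[OF bl]] .
  then have "((\<lambda>t. cascade \<rho> (\<lambda>l. complex_of_real (\<xi> t l $ i $ q)) j 1) has_vector_derivative
      \<epsilon> *\<^sub>R cascade \<rho> (\<lambda>l. complex_of_real (\<xi> t l $ i $ q)) j (Suc 1)) (at t within {0..})"
    using assms(2) by (intro has_vector_derivative_cascade[of n]) auto
  moreover have "\<zeta> \<rho> (Suc j) i q t + \<rho> j * \<zeta> \<rho> j i q t
      = cascade \<rho> (\<lambda>l. complex_of_real (\<xi> t l $ i $ q)) j (Suc 1)"
    by (simp add: \<zeta>_def)
  ultimately show ?thesis
    unfolding \<zeta>_def[abs_def] by metis
qed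

text \<open>Past the last mode the cascade is the characteristic combination of derivatives, which
  \<open>forcing_eq\<close> evaluates.\<close>

lemma \<zeta>_last_le:
  assumes "t \<ge> 0"
    and \<rho>: "\<And>\<xi>. cascade \<rho> \<xi> (n - 1) 1 = (\<Sum>l = 1..n. of_real (K l) * \<xi> l)"
  shows "norm (\<zeta> \<rho> (n - 1) i q t) \<le> norm (forcing t) / \<epsilon> ^ n"
proof -
  have "\<zeta> \<rho> (n - 1) i q t = of_real ((\<Sum>l = 1..n. K l *\<^sub>R \<xi> t l) $ i $ q)"
    unfolding \<zeta>_def \<rho> by simp
  also have "(\<Sum>l = 1..n. K l *\<^sub>R \<xi> t l) = \<xi> t n + (\<Sum>l = 1..<n. k l *\<^sub>R \<xi> t l)"
    using n by (simp add: char_coeffs_def sum.last_plus atLeastLessThanSuc_atLeastAtMost[symmetric])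
  finally have "norm (\<zeta> \<rho> (n - 1) i q t) = norm (((1 / \<epsilon> ^ n) *\<^sub>R forcing t) $ i $ q)"
    by (simp only: forcing_eq[OF assms(1)] norm_of_real) simp
  also have "\<dots> \<le> norm ((1 / \<epsilon> ^ n) *\<^sub>R forcing t)"
    by (meson Finite_Cartesian_Product.norm_nth_le order_trans)
  finally show ?thesis
    using \<epsilon>_pos by simp
qed

text \<open>Undoing the scaling costs \<open>\<epsilon> ^ l\<close>, which is at most
  \<open>\<epsilon> ^ (n - 1)\<close> for the derivatives that enter \<open>f\<close>.\<close>

lemma drift_le:
  "norm (\<Delta> t) \<le> L_slow * norm (\<xi> t 0) + \<epsilon> ^ (n - 1) * L_fast * \<Phi> t"
proof -
  have comp: "norm (\<Delta> t $ i) \<le> l\<^sub>x * norm (\<xi> t 0) + \<epsilon> ^ (n - 1) * (\<Sum>l = 1..<n. l\<^sub>d l) * \<Phi> t" for i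
  proof -
    have "norm (\<Delta> t $ i) \<le> l\<^sub>x * norm (\<xi> t 0 $ i) + (\<Sum>l = 1..<n. l\<^sub>d l * norm (x l t $ i))"
      using f_lipschitz[of "map (\<lambda>l. x l t $ i) [0..<n]"
          "map (\<lambda>l. if l = 0 then x_star $ i else 0) [0..<n]" i] n
      by (simp add: drift_def y_star_def scaled_def)
    also have "\<dots> \<le> l\<^sub>x * norm (\<xi> t 0) + (\<Sum>l = 1..<n. l\<^sub>d l * (\<epsilon> ^ (n - 1) * \<Phi> t))"
    proof (intro add_mono mult_left_mono sum_mono l\<^sub>x Finite_Cartesian_Product.norm_nth_le)
      fix l assume l: "l \<in> {1..<n}"
      have "norm (x l t $ i) \<le> norm (x l t)"
        by (rule Finite_Cartesian_Product.norm_nth_le)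
      also have "\<dots> = \<epsilon> ^ l * norm (\<xi> t l)"
        using l \<epsilon>_pos by (simp add: scaled_def)
      also have "\<dots> \<le> \<epsilon> ^ (n - 1) * \<Phi> t"
        unfolding \<Phi>_def using l \<epsilon> by (intro mult_mono power_increasing member_le_sum) auto
      finally show "norm (x l t $ i) \<le> \<epsilon> ^ (n - 1) * \<Phi> t" .
    qed (use l\<^sub>d in auto)
    also have "\<dots> = l\<^sub>x * norm (\<xi> t 0) + \<epsilon> ^ (n - 1) * (\<Sum>l = 1..<n. l\<^sub>d l) * \<Phi> t"
      by (simp add: mult_ac flip: sum_distrib_right)
    finally show ?thesis .
  qed
  have "norm (\<Delta> t) \<le> (\<Sum>i\<in>UNIV. norm (\<Delta> t $ i))"
    by (rule norm_le_sum_norm_nth)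
  also have "\<dots> \<le> (\<Sum>i\<in>(UNIV::'a set). l\<^sub>x * norm (\<xi> t 0) + \<epsilon> ^ (n - 1) * (\<Sum>l = 1..<n. l\<^sub>d l) * \<Phi> t)"
    by (intro sum_mono comp)
  also have "\<dots> = real N * l\<^sub>x * norm (\<xi> t 0) + \<epsilon> ^ (n - 1) * (real N * (\<Sum>l = 1..<n. l\<^sub>d l)) * \<Phi> t"
    by (simp add: N algebra_simps)
  finally show ?thesis
    by (simp only: L_slow_def L_fast_def)
qed

lemma gradient_error_le: "norm (G t - pseudo_gradient J (x_star + \<xi> t 0)) \<le> \<theta> * \<Psi> t"
proof -
  let ?e = "\<lambda>i j. if \<exists>u v :: 'a. u \<noteq> v then norm (xh t $ i $ j - x 0 t $ j) else 0"
  have comp: "norm ((G t - pseudo_gradient J (x_star + \<xi> t 0)) $ i) \<le> \<theta> * (\<Sum>j\<in>UNIV. ?e i j)" for i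
  proof -
    let ?r = "replace_decision (xh t $ i) i (x 0 t $ i)"
    have "norm ((G t - pseudo_gradient J (x_star + \<xi> t 0)) $ i) \<le> \<theta> * norm (?r - x 0 t)"
      using norm_partial_gradient_diff_le[OF lipschitz, of i ?r "x 0 t"]
      by (simp add: estimated_pseudo_gradient_def estimated_gradient_def pseudo_gradient_def scaled_def)
    also have "\<dots> \<le> \<theta> * (\<Sum>j\<in>UNIV. norm ((?r - x 0 t) $ j))"
      using \<theta> by (intro mult_left_mono norm_le_sum_norm_nth) auto
    \<comment> \<open>The own component of \<open>?r\<close> is exact, so a nonzero summand requires
      a second player.\<close>
    also have "\<dots> \<le> \<theta> * (\<Sum>j\<in>UNIV. ?e i j)"
      using \<theta> by (intro mult_left_mono sum_mono) auto
    finally show ?thesis .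
  qed
  have "norm (G t - pseudo_gradient J (x_star + \<xi> t 0))
      \<le> (\<Sum>i\<in>UNIV. norm ((G t - pseudo_gradient J (x_star + \<xi> t 0)) $ i))"
    by (rule norm_le_sum_norm_nth)
  also have "\<dots> \<le> (\<Sum>i\<in>UNIV. \<theta> * (\<Sum>j\<in>UNIV. ?e i j))"
    by (intro sum_mono comp)
  finally show ?thesis
    by (simp add: \<Psi>_def sum_distrib_left)
qed

end


section \<open>Modes, their amplitudes and growth\<close>

datatype ('p, 'm) mode = Slow | Integral | Chain nat 'p 'm | Estimate 'p 'p

context nash_seeking_solution
begin

lemma \<Psi>_nonneg: "0 \<le> \<Psi> t"
  by (auto simp: \<Psi>_def intro!: sum_nonneg)

lemma solution_estimates:
  shows "norm (\<xi> t 0) \<le> norm (p t) / K 1 + K_sum * \<Phi> t"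
    and "p t \<bullet> forcing t \<le> norm (p t) * ((\<beta> - gain * \<omega> / K 1) * norm (p t) + norm (s t)
      + \<epsilon> ^ (n - 1) * C_fast * \<Phi> t + gain * \<theta> * \<Psi> t)"
    and "s t \<bullet> (\<Delta> t - (s t - \<xi> t (n - 1)))
      \<le> norm (s t) * (\<beta> * norm (p t) - norm (s t) + \<epsilon> ^ (n - 1) * C_fast * \<Phi> t)"
    and "norm (forcing t) \<le> (\<beta> + gain * \<theta> / K 1) * norm (p t) + norm (s t)
      + \<epsilon> ^ (n - 1) * C_fast * \<Phi> t + gain * \<theta> * \<Psi> t"
proof -
  have E: "1 \<le> \<epsilon> ^ (n - 1)"
    using \<epsilon> by (rule one_le_power)
  note inst = E drift_le gradient_error_le
  show "norm (\<xi> t 0) \<le> norm (p t) / K 1 + K_sum * \<Phi> t"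
    using slow_estimates(1)[where \<xi> = "\<xi> t", folded \<Phi>_def p_def, OF inst] .
  note * = slow_estimates(2-4)[where \<xi> = "\<xi> t" and s = "s t", folded \<Phi>_def p_def, OF inst, folded forcing_def]
  from *(1) show "p t \<bullet> forcing t \<le> norm (p t) * ((\<beta> - gain * \<omega> / K 1) * norm (p t) + norm (s t)
      + \<epsilon> ^ (n - 1) * C_fast * \<Phi> t + gain * \<theta> * \<Psi> t)" .
  from *(2) show "s t \<bullet> (\<Delta> t - (s t - \<xi> t (n - 1)))
      \<le> norm (s t) * (\<beta> * norm (p t) - norm (s t) + \<epsilon> ^ (n - 1) * C_fast * \<Phi> t)" .
  from *(3) show "norm (forcing t) \<le> (\<beta> + gain * \<theta> / K 1) * norm (p t) + norm (s t)
      + \<epsilon> ^ (n - 1) * C_fast * \<Phi> t + gain * \<theta> * \<Psi> t" .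
qed

primrec amplitude :: "(nat \<Rightarrow> complex) \<Rightarrow> ('a, 'b) mode \<Rightarrow> real \<Rightarrow> real" where
  "amplitude \<rho> Slow t = norm (p t)"
| "amplitude \<rho> Integral t = norm (s t)"
| "amplitude \<rho> (Chain j i q) t = norm (\<zeta> \<rho> j i q t)"
| "amplitude \<rho> (Estimate i j) t = norm (xh t $ i $ j - x 0 t $ j)"

text \<open>The derivatives of the squared amplitudes, with the right-hand sides of the mode
  equations inserted.\<close>

primrec growth :: "(nat \<Rightarrow> complex) \<Rightarrow> ('a, 'b) mode \<Rightarrow> real \<Rightarrow> real" where
  "growth \<rho> Slow t = 2 * (p t \<bullet> ((1 / \<epsilon> ^ (n - 1)) *\<^sub>R forcing t))"
| "growth \<rho> Integral t = 2 * (s t \<bullet> ((1 / \<epsilon> ^ (n - 1)) *\<^sub>R (\<Delta> t - (s t - \<xi> t (n - 1)))))"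
| "growth \<rho> (Chain j i q) t
    = 2 * (\<zeta> \<rho> j i q t \<bullet> (\<epsilon> *\<^sub>R (\<zeta> \<rho> (Suc j) i q t + \<rho> j * \<zeta> \<rho> j i q t)))"
| "growth \<rho> (Estimate i j) t = 2 * ((xh t $ i $ j - x 0 t $ j) \<bullet>
    (\<epsilon> *\<^sub>R (- ((\<Sum>q\<in>UNIV. a $ i $ q *\<^sub>R ((xh t $ i $ j - x 0 t $ j) - (xh t $ q $ j - x 0 t $ j)))
      + a $ i $ j *\<^sub>R (xh t $ i $ j - x 0 t $ j)) - \<xi> t 1 $ j)))"

lemma amplitude_deriv:
  assumes "t \<ge> 0" and "\<And>j i q. z = Chain j i q \<Longrightarrow> j < n - 1"
  shows "((\<lambda>t. (amplitude \<rho> z t)\<^sup>2) has_real_derivative growth \<rho> z t) (at t within {0..})"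
proof (cases z)
  case Slow
  then show ?thesis
    using has_real_derivative_norm_square[OF p_deriv[OF assms(1)]] by simp
next
  case Integral
  then show ?thesis
    using has_real_derivative_norm_square[OF s_deriv[OF assms(1)]] by simp
next
  case (Chain j i q)
  then show ?thesis
    using has_real_derivative_norm_square[OF \<zeta>_deriv[OF assms]] by simp
next
  case (Estimate i j)
  then show ?thesis
    using has_real_derivative_norm_square[OF estimate_deriv[OF assms(1)]] by simp
qed

end

section \<open>Choice of weights and exponential convergence\<close>

context nash_seeking
begin

lemma exponential_convergence:
  "\<exists>\<epsilon>>0. \<exists>r>0. \<forall>x y xh. closed_loop_solution n a J f w k gain 1 \<epsilon> \<epsilon> x y xh \<longrightarrow>
     (\<exists>C>0. \<forall>t\<ge>0. norm (x 0 t - x_star) \<le> C * exp (- r * t))"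
proof -
  note pos = constants_nonneg K1_pos \<omega> \<theta>
  obtain \<rho> where \<rho>: "\<And>j. j < n - 1 \<Longrightarrow> Re (\<rho> j) < 0"
    and \<rho>_last: "\<And>\<xi>. cascade \<rho> \<xi> (n - 1) 1 = (\<Sum>l = 1..n. of_real (K l) * \<xi> l)"
    by (rule hurwitz_roots[OF n hurwitz]; (assumption | (rule that; blast)))
  obtain c where c: "\<And>j. j \<le> n - 1 \<Longrightarrow> 0 < c j"
    and c_Suc: "\<And>j. 2 * c (Suc j) = - Re (\<rho> j) * c j"
    by (rule chain_weights[OF \<rho>]; (assumption | (rule that; simp del: One_nat_def)))
  have c': "0 < c j" if "j < n - 1" for j
    using c that by simp
  obtain B where B: "0 \<le> B"
    and \<Phi>_le: "\<And>(\<xi> :: nat \<Rightarrow> ('m, 'p) profile) h. 0 \<le> h \<Longrightarrow>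
      (\<And>j i q. j < n - 1 \<Longrightarrow> norm (cascade \<rho> (\<lambda>l. of_real (\<xi> l $ i $ q)) j 1) \<le> h * c j) \<Longrightarrow>
      (\<Sum>l = 1..<n. norm (\<xi> l)) \<le> h * B"
    by (rule chain_state_bound[of n c \<rho>, OF c']; (assumption | (rule that; blast)))
  \<comment> \<open>Graph weights exist once there are two players; otherwise no estimation mode
    enters \<open>I\<close> and the values 1 serve as placeholders.\<close>
  define multi where "multi \<longleftrightarrow> (\<exists>u v :: 'p. u \<noteq> v)"
  obtain d :: "'p \<Rightarrow> 'p \<Rightarrow> real" and m where m: "m > 0" and d: "\<And>i j. 0 < d i j"
    and dm: "\<And>i j. multi \<Longrightarrow> m \<le> (\<Sum>q\<in>UNIV. a $ i $ q * (d i j - d q j)) + a $ i $ j * d i j"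
  proof (cases multi)
    case True
    then obtain u v :: 'p where uv: "u \<noteq> v"
      by (auto simp: multi_def)
    show ?thesis
    proof (rule strongly_connected_weights[OF digraph connected uv])
      fix d :: "'p \<Rightarrow> 'p \<Rightarrow> real" and m :: real
      assume "0 < m" "\<And>i j. 0 < d i j"
        "\<And>i j. m \<le> (\<Sum>q\<in>UNIV. a $ i $ q * (d i j - d q j)) + a $ i $ j * d i j"
      then show ?thesis
        by (rule that)
    qed
  next
    case False
    then show ?thesis
      using that[of 1 "\<lambda>_ _. 1"] by simp
  qed
  define \<gamma> where "\<gamma> = c (n - 1)"
  have \<gamma>: "0 < \<gamma>"
    by (simp add: \<gamma>_def c)
  \<comment> \<open>Scales the graph weights so that their margin exceeds the velocity bound
    \<open>B + \<gamma>\<close> by 1.\<close>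
  define D where "D = (B + \<gamma> + 1) / m"
  have D: "0 < D" "D * m = B + \<gamma> + 1"
    using B \<gamma> m by (auto simp: D_def)
  define S where "S = D * (\<Sum>i\<in>UNIV. \<Sum>j\<in>UNIV. d i j)"
  have S: "0 \<le> S"
    unfolding S_def using D(1) by (intro mult_nonneg_nonneg sum_nonneg less_imp_le[OF d]) simp
  define g where "g = \<beta> + gain * \<theta> / K 1 + \<sigma> + 1 / 2"
  have g: "0 < g"
    using pos by (simp add: g_def add_pos_pos)
  \<comment> \<open>Then a forcing of size \<open>h * g\<close>, divided by
    \<open>\<epsilon> ^ n\<close>, equals \<open>h * \<mu> * \<gamma>\<close>, the level required
    past the last chain mode.\<close>
  define M where "M = g / \<gamma>"
  have M: "0 < M" "M * \<gamma> = g"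
    using g \<gamma> by (auto simp: M_def)
  define P where "P = C_fast * B + gain * \<theta> * S"
  \<comment> \<open>At level \<open>h\<close> the fast modes perturb the slow ones by at most
    \<open>h * M * P / \<epsilon>\<close>, which this choice makes at most \<open>h / 2\<close>.
    There is no circularity, because \<open>M\<close> and \<open>P\<close> are free of
    \<epsilon>.\<close>
  define \<epsilon> where "\<epsilon> = max 1 (2 * (M * P))"
  have eps: "1 \<le> \<epsilon>" "2 * (M * P) \<le> \<epsilon>"
    by (auto simp: \<epsilon>_def)
  define \<mu> where "\<mu> = M / \<epsilon> ^ n"
  have \<mu>: "0 < \<mu>"
    using M eps by (simp add: \<mu>_def)
  define W where "W z = (case z of Slow \<Rightarrow> 1 | Integral \<Rightarrow> \<sigma> | Chain j i q \<Rightarrow> \<mu> * c j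
      | Estimate i j \<Rightarrow> \<mu> * (D * d i j))" for z :: "('p, 'm) mode"
  \<comment> \<open>Twice the margins of the individual dissipation estimates, including the
    time-scale factors of the mode equations.\<close>
  define V where "V z = (case z of Slow \<Rightarrow> 1 / \<epsilon> ^ (n - 1) | Integral \<Rightarrow> \<sigma> / \<epsilon> ^ (n - 1)
      | Chain j i q \<Rightarrow> 2 * \<epsilon> * \<mu>\<^sup>2 * (c j * c (Suc j))
      | Estimate i j \<Rightarrow> 2 * \<epsilon> * \<mu>\<^sup>2 * (D * d i j))" for z :: "('p, 'm) mode"
  define I :: "('p, 'm) mode set" where "I = {z. case z of Chain j i q \<Rightarrow> j < n - 1 | Estimate i j \<Rightarrow> multi | _ \<Rightarrow> True}"
  have "I \<subseteq> {Slow, Integral} \<union> (\<lambda>(j, i, q). Chain j i q) ` ({..<n - 1} \<times> UNIV \<times> UNIV)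
      \<union> range (\<lambda>(i, j). Estimate i j)"
  proof
    fix z assume "z \<in> I"
    then show "z \<in> {Slow, Integral} \<union> (\<lambda>(j, i, q). Chain j i q) ` ({..<n - 1} \<times> UNIV \<times> UNIV)
        \<union> range (\<lambda>(i, j). Estimate i j)"
      by (cases z) (auto simp: I_def image_iff)
  qed
  then have fin: "finite I"
    by (rule finite_subset) (intro finite_UnI finite_imageI, auto)
  have W_pos: "0 < W z" and V_pos: "0 < V z" if "z \<in> I" for z
    using that pos \<mu> c[of "Suc _"] c D(1) d eps(1)
    by (cases z; auto simp: I_def W_def V_def)+
  obtain r where "r > 0" and decay: "\<And>N N'.
      (\<And>z t. z \<in> I \<Longrightarrow> t \<ge> 0 \<Longrightarrow> 0 \<le> N z t) \<Longrightarrow>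
      (\<And>z t. z \<in> I \<Longrightarrow> t \<ge> 0 \<Longrightarrow>
         ((\<lambda>t. (N z t)\<^sup>2) has_real_derivative N' z t) (at t within {0..})) \<Longrightarrow>
      (\<And>z t h. z \<in> I \<Longrightarrow> t \<ge> 0 \<Longrightarrow> 0 < h \<Longrightarrow> (\<And>j. j \<in> I \<Longrightarrow> N j t \<le> h * W j) \<Longrightarrow>
         N z t = h * W z \<Longrightarrow> N' z t \<le> - V z * h\<^sup>2) \<Longrightarrow>
      \<exists>C>0. \<forall>z\<in>I. \<forall>t\<ge>0. N z t \<le> C * W z * exp (- r * t)"
    by (rule vector_lyapunov_decay[of I W V, OF fin W_pos V_pos]; (assumption | (rule that; blast)))
  have "\<exists>C>0. \<forall>t\<ge>0. norm (x 0 t - x_star) \<le> C * exp (- r * t)"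
    if sol: "closed_loop_solution n a J f w k gain 1 \<epsilon> \<epsilon> x y xh" for x y xh
  proof -
    interpret nash_seeking_solution a J n f w l\<^sub>x l\<^sub>d \<omega> \<theta> k x_star N \<epsilon> x y xh
      by unfold_locales (use eps sol in auto)
    have \<Phi>_level: "\<Phi> t \<le> h * \<mu> * B"
      if "0 \<le> h" "\<And>z. z \<in> I \<Longrightarrow> amplitude \<rho> z t \<le> h * W z" for h t
      unfolding \<Phi>_def
    proof (rule \<Phi>_le)
      show "0 \<le> h * \<mu>"
        using that(1) \<mu> by simp
      show "norm (cascade \<rho> (\<lambda>l. of_real (\<xi> t l $ i $ q)) j 1) \<le> h * \<mu> * c j" if "j < n - 1" for j i q
      proof -
        have "Chain j i q \<in> I"
          using that by (auto simp: I_def)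
        from \<open>\<And>z. z \<in> I \<Longrightarrow> amplitude \<rho> z t \<le> h * W z\<close>[OF this] show ?thesis
          by (simp add: \<zeta>_def W_def mult.assoc)
      qed
    qed
    have "\<exists>C>0. \<forall>z\<in>I. \<forall>t\<ge>0. amplitude \<rho> z t \<le> C * W z * exp (- r * t)"
    proof (rule decay)
      show "0 \<le> amplitude \<rho> z t" for z t
        by (cases z) auto
      show "((\<lambda>t. (amplitude \<rho> z t)\<^sup>2) has_real_derivative growth \<rho> z t) (at t within {0..})"
        if "z \<in> I" "t \<ge> 0" for z t
        using that by (intro amplitude_deriv) (simp_all add: I_def)
    next
      fix z t and h :: real
      assume z: "z \<in> I" and t: "t \<ge> 0" and h: "0 < h"
        and le: "\<And>z. z \<in> I \<Longrightarrow> amplitude \<rho> z t \<le> h * W z" and eq: "amplitude \<rho> z t = h * W z"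
      have p_le: "norm (p t) \<le> h" and s_le: "norm (s t) \<le> h * \<sigma>"
        using le[of Slow] le[of Integral] by (auto simp: I_def W_def)
      have e_le: "norm (xh t $ i $ j - x 0 t $ j) \<le> h * \<mu> * (D * d i j)" if multi for i j
      proof -
        have "Estimate i j \<in> I"
          using that by (auto simp: I_def)
        from le[OF this] show ?thesis
          by (simp add: W_def mult.assoc)
      qed
      have \<Phi>_h: "\<Phi> t \<le> h * \<mu> * B"
        using h le by (intro \<Phi>_level) auto
      have \<Psi>_h: "\<Psi> t \<le> h * \<mu> * S"
      proof -
        have "\<Psi> t \<le> (\<Sum>i\<in>UNIV. \<Sum>j\<in>UNIV. h * \<mu> * (D * d i j))"
          unfolding \<Psi>_def
        proof (intro sum_mono)
          fix i j
          have "0 \<le> h * \<mu> * (D * d i j)"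
            using h \<mu> D d[of i j] by simp
          then show "(if \<exists>u v :: 'p. u \<noteq> v then norm (xh t $ i $ j - x 0 t $ j) else 0)
              \<le> h * \<mu> * (D * d i j)"
            using e_le[of i j] by (simp add: multi_def)
        qed
        also have "\<dots> = h * \<mu> * S"
          by (simp add: S_def sum_distrib_left mult_ac)
        finally show ?thesis .
      qed
      have pert: "\<epsilon> ^ (n - 1) * C_fast * \<Phi> t + gain * \<theta> * \<Psi> t \<le> h / 2"
      proof -
        have \<mu>1: "\<epsilon> ^ (n - 1) * \<mu> = M / \<epsilon>"
          using eps(1) n by (simp add: \<mu>_def power_diff)
        have "\<epsilon> ^ 1 \<le> \<epsilon> ^ n"
          using eps(1) n by (intro power_increasing) auto
        \<comment> \<open>The derivative errors carry the factor \<open>\<epsilon> ^ (n - 1)\<close>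
          and use the preceding identity; the estimation errors carry none, and this cruder bound
          suffices.\<close>
        then have \<mu>2: "\<mu> \<le> M / \<epsilon>"
          unfolding \<mu>_def using M eps(1) by (intro divide_left_mono) auto
        have "\<epsilon> ^ (n - 1) * C_fast * \<Phi> t \<le> \<epsilon> ^ (n - 1) * C_fast * (h * \<mu> * B)"
          using pos eps(1) by (intro mult_left_mono \<Phi>_h) auto
        also have "\<dots> = (\<epsilon> ^ (n - 1) * \<mu>) * (h * (C_fast * B))"
          by (simp add: mult_ac)
        also have "\<dots> = M / \<epsilon> * (h * (C_fast * B))"
          by (simp only: \<mu>1)
        finally have 1: "\<epsilon> ^ (n - 1) * C_fast * \<Phi> t \<le> M / \<epsilon> * (h * (C_fast * B))" .
        have "gain * \<theta> * \<Psi> t \<le> gain * \<theta> * (h * \<mu> * S)"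
          using pos by (intro mult_left_mono \<Psi>_h) auto
        also have "\<dots> = \<mu> * (h * (gain * \<theta> * S))"
          by (simp add: mult_ac)
        also have "\<dots> \<le> M / \<epsilon> * (h * (gain * \<theta> * S))"
          using \<mu>2 h S pos by (intro mult_right_mono) auto
        finally have "\<epsilon> ^ (n - 1) * C_fast * \<Phi> t + gain * \<theta> * \<Psi> t \<le> M / \<epsilon> * (h * P)"
          using 1 by (simp add: P_def algebra_simps add_divide_distrib)
        also have "\<dots> = h * (M * P / \<epsilon>)"
          by simp
        also have "\<dots> \<le> h * (1 / 2)"
          using h eps by (intro mult_left_mono) (auto simp: field_simps)
        finally show ?thesis
          by simp
      qed
      note slow = slow_dissipation[OF p_le s_le pert \<Psi>_nonneg]
      have "norm (forcing t) \<le> h * g"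
        unfolding g_def using solution_estimates(4) slow(3) by (rule order_trans)
      then have "norm (forcing t) / \<epsilon> ^ n \<le> h * g / \<epsilon> ^ n"
        using eps(1) by (intro divide_right_mono) auto
      also have "\<dots> = h * \<mu> * \<gamma>"
        unfolding M(2)[symmetric] \<mu>_def by simp
      finally have forcing: "norm (forcing t) / \<epsilon> ^ n \<le> h * \<mu> * \<gamma>" .
      have h\<mu>: "0 \<le> h * \<mu>"
        using h \<mu> by simp
      consider "z = Slow" | "z = Integral" | j i q where "z = Chain j i q" "j < n - 1"
        | i j where "z = Estimate i j" multi
        using z by (cases z) (auto simp: I_def)
      then show "growth \<rho> z t \<le> - V z * h\<^sup>2"
      proof cases
        case 1
        then have "norm (p t) = h"
          using eq by (simp add: W_def)
        have "p t \<bullet> forcing t \<le> norm (p t) * - (h / 2)"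
          using solution_estimates(2) mult_left_mono[OF slow(1)[OF \<open>norm (p t) = h\<close>] norm_ge_zero]
          by (rule order_trans)
        then have "(2 / \<epsilon> ^ (n - 1)) * (p t \<bullet> forcing t) \<le> (2 / \<epsilon> ^ (n - 1)) * (h * - (h / 2))"
          using eps(1) \<open>norm (p t) = h\<close> by (intro mult_left_mono) auto
        then show ?thesis
          by (simp add: 1 V_def power2_eq_square)
      next
        case 2
        then have *: "norm (s t) = h * \<sigma>"
          using eq by (simp add: W_def)
        have "s t \<bullet> (\<Delta> t - (s t - \<xi> t (n - 1))) \<le> norm (s t) * - (h / 2)"
          using solution_estimates(3) mult_left_mono[OF slow(2)[OF *] norm_ge_zero]
          by (rule order_trans)
        then have "(2 / \<epsilon> ^ (n - 1)) * (s t \<bullet> (\<Delta> t - (s t - \<xi> t (n - 1))))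
            \<le> (2 / \<epsilon> ^ (n - 1)) * (h * \<sigma> * - (h / 2))"
          using eps(1) * by (intro mult_left_mono) auto
        then show ?thesis
          by (simp add: 2 V_def power2_eq_square mult_ac)
      next
        case (3 j i q)
        \<comment> \<open>The last chain mode is driven by the forcing, every other one by its
          successor.\<close>
        have next_le: "norm (\<zeta> \<rho> (Suc j) i q t) \<le> h * \<mu> * c (Suc j)"
        proof (cases "Suc j = n - 1")
          case True
          then show ?thesis
            using \<zeta>_last_le[OF t \<rho>_last, of i q] forcing by (simp add: \<gamma>_def)
        next
          case False
          then have "Chain (Suc j) i q \<in> I"
            using 3 by (auto simp: I_def)
          from le[OF this] show ?thesis
            by (simp add: W_def mult.assoc)
        qed
        have "norm (\<zeta> \<rho> j i q t) = h * \<mu> * c j"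
          using eq by (simp add: 3 W_def mult.assoc)
        moreover have "0 \<le> h * \<mu> * c j"
          using h\<mu> c[of j] 3 by simp
        ultimately have "\<zeta> \<rho> j i q t \<bullet> (\<zeta> \<rho> (Suc j) i q t + \<rho> j * \<zeta> \<rho> j i q t)
            \<le> - ((h * \<mu>)\<^sup>2 * c j * c (Suc j))"
          by (intro chain_dissipation next_le c_Suc)
        then have "2 * \<epsilon> * (\<zeta> \<rho> j i q t \<bullet> (\<zeta> \<rho> (Suc j) i q t + \<rho> j * \<zeta> \<rho> j i q t))
            \<le> 2 * \<epsilon> * - ((h * \<mu>)\<^sup>2 * c j * c (Suc j))"
          using eps(1) by (intro mult_left_mono) auto
        then show ?thesis
          by (simp add: 3 V_def power_mult_distrib mult_ac)
      next
        case (4 i j)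
        let ?e = "\<lambda>q. xh t $ q $ j - x 0 t $ j"
        have "?e i \<bullet> (- ((\<Sum>q\<in>UNIV. a $ i $ q *\<^sub>R (?e i - ?e q)) + a $ i $ j *\<^sub>R ?e i) - \<xi> t 1 $ j)
            \<le> - ((h * \<mu>)\<^sup>2 * (D * d i j) * (D * m - (B + \<gamma>)))"
        proof (rule estimate_dissipation)
          show "0 \<le> a $ i $ q" for q
            using digraph by (simp add: weighted_digraph_def)
          then show "0 \<le> a $ i $ j" .
          show "norm (?e q) \<le> h * \<mu> * (D * d q j)" for q
            by (rule e_le[OF 4(2)])
          show "norm (?e i) = h * \<mu> * (D * d i j)"
            using eq by (simp add: 4 W_def mult.assoc)
          have "norm (\<xi> t 1 $ j) \<le> norm (\<xi> t 1)"
            by (rule Finite_Cartesian_Product.norm_nth_le)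
          also have "\<dots> \<le> h * \<mu> * B + h * \<mu> * \<gamma>"
            using \<xi>1_le[OF t] \<Phi>_h forcing by linarith
          finally show "norm (\<xi> t 1 $ j) \<le> h * \<mu> * (B + \<gamma>)"
            by (simp add: distrib_left)
          have "D * m \<le> D * ((\<Sum>q\<in>UNIV. a $ i $ q * (d i j - d q j)) + a $ i $ j * d i j)"
            using D(1) by (intro mult_left_mono dm 4(2)) auto
          also have "\<dots> = (\<Sum>q\<in>UNIV. a $ i $ q * (D * d i j - D * d q j)) + a $ i $ j * (D * d i j)"
            by (simp add: distrib_left sum_distrib_left right_diff_distrib mult_ac)
          finally show "D * m \<le> \<dots>" .
        qed (fact h\<mu>)
        then have "2 * \<epsilon> * (?e i \<bullet> (- ((\<Sum>q\<in>UNIV. a $ i $ q *\<^sub>R (?e i - ?e q)) + a $ i $ j *\<^sub>R ?e i) - \<xi> t 1 $ j))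
            \<le> 2 * \<epsilon> * - ((h * \<mu>)\<^sup>2 * (D * d i j))"
          using eps(1) by (intro mult_left_mono) (auto simp: D(2))
        then show ?thesis
          unfolding 4(1) growth.simps by (simp add: V_def power_mult_distrib mult_ac)
      qed
    qed
    then obtain C where "C > 0" and C_le: "\<forall>z\<in>I. \<forall>t\<ge>0. amplitude \<rho> z t \<le> C * W z * exp (- r * t)"
      by blast
    have C: "amplitude \<rho> z t \<le> C * exp (- r * t) * W z" if "z \<in> I" "t \<ge> 0" for z t
    proof -
      have "amplitude \<rho> z t \<le> C * W z * exp (- r * t)"
        using C_le that by blast
      also have "\<dots> = C * exp (- r * t) * W z"
        by (simp only: mult_ac)
      finally show ?thesis .
    qed
    \<comment> \<open>The decision error is recovered from \<open>p\<close> and the derivatives, all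
      bounded at the common level \<open>C * exp (- r * t)\<close>.\<close>
    have "norm (x 0 t - x_star) \<le> C * (1 / K 1 + K_sum * \<mu> * B) * exp (- r * t)" if t: "t \<ge> 0" for t
    proof -
      define h where "h = C * exp (- r * t)"
      have "norm (p t) \<le> h"
        using C[of Slow, OF _ t] by (simp add: I_def W_def h_def)
      moreover have "\<Phi> t \<le> h * \<mu> * B"
        using C t \<open>C > 0\<close> by (intro \<Phi>_level) (auto simp: h_def)
      ultimately have "norm (p t) / K 1 + K_sum * \<Phi> t \<le> h / K 1 + K_sum * (h * \<mu> * B)"
        using pos by (intro add_mono divide_right_mono mult_left_mono) auto
      moreover have "norm (x 0 t - x_star) \<le> norm (p t) / K 1 + K_sum * \<Phi> t"
        using solution_estimates(1)[of t] by (simp add: scaled_def)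
      ultimately show ?thesis
        by (simp add: h_def algebra_simps)
    qed
    moreover have "0 < C * (1 / K 1 + K_sum * \<mu> * B)"
      using \<open>C > 0\<close> pos \<mu> B by (intro mult_pos_pos add_pos_nonneg) auto
    ultimately show ?thesis
      by blast
  qed
  then show ?thesis
    using \<open>r > 0\<close> eps(1) by (intro exI[of _ \<epsilon>] exI[of _ r] conjI) auto
qed

end

section \<open>The unique equilibrium and convergence to it\<close>

theorem theorem2:
  fixes a :: "real ^ 'p::finite ^ 'p"
    and J :: "'p \<Rightarrow> ('m::finite, 'p) profile \<Rightarrow> real"
    and n :: nat
    and f :: "'p \<Rightarrow> (real ^ 'm) list \<Rightarrow> real list \<Rightarrow> real ^ 'm"
    and w :: "'p \<Rightarrow> real list"
    and l\<^sub>x :: real and l\<^sub>d :: "nat \<Rightarrow> real"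
    and \<omega> \<theta> :: real
    and k :: "nat \<Rightarrow> real"
  assumes "n \<ge> 1"
    and "weighted_digraph a"
    and "strongly_connected a"
    and "l\<^sub>x \<ge> 0" and "\<And>l. l \<in> {1..<n} \<Longrightarrow> l\<^sub>d l \<ge> 0"
    and "\<And>i xs zs. length xs = n \<Longrightarrow> length zs = n \<Longrightarrow>
           norm (f i xs (w i) - f i zs (w i))
             \<le> l\<^sub>x * norm (xs ! 0 - zs ! 0) + (\<Sum>l = 1..<n. l\<^sub>d l * norm (xs ! l - zs ! l))"
    and "\<And>i. continuously_differentiable (J i)"
    and "\<And>i x. convex_on UNIV (\<lambda>z. J i (replace_decision x i z))"
    and "\<omega> > 0" and "strongly_monotone \<omega> (pseudo_gradient J)"
    and "\<theta> > 0" and "\<theta>-lipschitz_on UNIV (pseudo_gradient J)"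
    and "\<And>s::complex. s ^ (n - 1) + (\<Sum>l = 1..<n. of_real (k l) * s ^ (l - 1)) = 0 \<Longrightarrow> Re s < 0"
  shows "\<exists>x_star. (\<forall>z. nash_equilibrium J z \<longleftrightarrow> z = x_star) \<and>
    (\<exists>\<alpha>\<^sub>1>0. \<exists>\<alpha>\<^sub>2>0. \<exists>\<alpha>\<^sub>3>0. \<exists>\<epsilon>>0. \<exists>r>0.
       \<forall>x y xh. closed_loop_solution n a J f w k \<alpha>\<^sub>1 \<alpha>\<^sub>2 \<alpha>\<^sub>3 \<epsilon> x y xh \<longrightarrow>
         (\<exists>C>0. \<forall>t\<ge>0. norm (x 0 t - x_star) \<le> C * exp (- r * t)))"
proof -
  have equilibrium_iff: "nash_equilibrium J z \<longleftrightarrow> pseudo_gradient J z = 0" for z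
    using assms(7,8) by (rule nash_equilibrium_iff)
  \<comment> \<open>Contraction gives exactly one zero of the pseudo-gradient; by
    \<open>equilibrium_iff\<close> it is the only Nash equilibrium.\<close>
  obtain x_star where zero: "\<And>z. pseudo_gradient J z = 0 \<longleftrightarrow> z = x_star"
    using strongly_monotone_unique_zero[OF assms(9,11,10,12)] by metis
  interpret nash_seeking a J n f w l\<^sub>x l\<^sub>d \<omega> \<theta> k x_star "CARD('p)"
    using assms zero by unfold_locales auto
  obtain \<epsilon> r where "\<epsilon> > 0" "r > 0" and
    "\<And>x y xh. closed_loop_solution n a J f w k gain 1 \<epsilon> \<epsilon> x y xh \<Longrightarrow>
       \<exists>C>0. \<forall>t\<ge>0. norm (x 0 t - x_star) \<le> C * exp (- r * t)"
    using exponential_convergence by blast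
  then show ?thesis
    using equilibrium_iff zero constants_nonneg(6) zero_less_one by blast
qed

end
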